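(* Let $X$ be an epitopological space. If $X\geq Td_TX$, then $T[X,\$]$ is core compact if and only if $X$ is a core compact topological space.
   Context: A convergence $\xi$ on a set $X$ is a relation between $X$ and the set $\mathbb{F}X$ of (proper) filters on $X$, written $x\in\lim_\xi\mathcal{F}$, such that $x\in\lim_\xi\{x\}^{\uparrow}$ for every $x$ (where $\{x\}^\uparrow$ is the principal ultrafilter of $x$) and $\lim_\xi\mathcal{F}\subseteq\lim_\xi\mathcal{G}$ whenever $\mathcal{F}\subseteq\mathcal{G}$. On a fixed set, $\xi\geq\tau$ ($\xi$ finer than $\tau$) means $\lim_\xi\mathcal{F}\subseteq\lim_\tau\mathcal{F}$ for all filters $\mathcal{F}$; suprema are given by $\lim_{\bigvee_i\xi_i}\mathcal{F}=\bigcap_i\lim_{\xi_i}\mathcal{F}$. For convergence spaces $X,W$ with the same underlying set, $X\geq W$ compares their convergences. A topological space is regarded as a convergence space by $x\in\lim\mathcal{F}$ iff $\mathcal{F}$ contains the neighborhood filter of $x$; a convergence arising this way is called topological. A subset $O$ is open if $O\in\mathcal{F}$ whenever $\lim\mathcal{F}\cap O\neq\emptyset$; $TX$ denotes the underlying set of $X$ with the topology of open subsets of $X$. A map $f$ is continuous if $x\in\lim\mathcal{F}$ implies $f(x)\in\lim f(\mathcal{F})$. For $f:X\to (Y,\tau)$, $f^{-}\tau$ denotes the coarsest convergence on $X$ making $f$ continuous. For convergence spaces $X,Y$, $[X,Y]$ is the set $C(X,Y)$ of continuous maps endowed with the continuous convergence: $f\in\lim_{[X,Y]}\mathcal{F}$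 iff for every $x\in X$ and every filter $\mathcal{G}$ with $x\in\lim_X\mathcal{G}$, $f(x)\in\lim_Y e(\mathcal{G}\times\mathcal{F})$, where $e(x,f)=f(x)$. $\$$ is the Sierpiński space $\{0,1\}$ with open sets $\emptyset,\{1\},\{0,1\}$. Let $i(x)(f)=f(x)$ for $x\in X$, $f\in C(X,\$)$. A convergence space $X$ is epitopological if $X=i^{-}[[X,\$],\$]$; every topological space is epitopological. Define $\operatorname{Epi}_T X:=i^{-}[T[X,\$],\$]$, a convergence on the underlying set of $X$, and transfinitely $\operatorname{Epi}_T^{1}=\operatorname{Epi}_T$, $\operatorname{Epi}_T^{\alpha}X=\operatorname{Epi}_T\left(\bigvee_{\beta<\alpha}\operatorname{Epi}_T^{\beta}X\right)$. For each epitopological $X$ there is an ordinal $\alpha(X)$ with $\operatorname{Epi}_T^{\alpha(X)}X=\operatorname{Epi}_T^{\alpha(X)+1}X$, and $d_TX$ denotes this common value. A topological space $Y$ is core compact if for every $y\in Y$ and every open set $O$ containing $y$ there is an open set $U$ containing $y$ such that every open cover of $O$ has a finite subfamily that covers $U$. *)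

theory Defs
  imports "HOL-Analysis.Abstract_Limits" "HOL-Library.FuncSet"
begin

section \<open>Convergence spaces\<close>

text \<open>
  A filter on a subset \<open>S\<close> of a type is represented by a filter \<open>F\<close> on the whole type with
  \<open>F \<le> principal S\<close>, and it is proper iff \<open>F \<noteq> bot\<close>. The order on the type of filters is
  reverse inclusion: \<open>G \<le> F\<close> says that every member of \<open>F\<close> is a member of \<open>G\<close>.
\<close>

definition proper_on :: "'a set \<Rightarrow> 'a filter \<Rightarrow> bool" where
  "proper_on S F \<longleftrightarrow> F \<noteq> bot \<and> F \<le> principal S"

text \<open>
  As in the type of topologies, the underlying set need not be the whole type. The first
  condition makes limits empty outside the proper filters on the underlying set, so that equality
  of values of this type is equality of convergence spaces.
\<close>

definition is_convergence :: "'a set \<times> ('a filter \<Rightarrow> 'a set) \<Rightarrow> bool" where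
  "is_convergence = (\<lambda>(S, L).
     (\<forall>F. L F \<noteq> {} \<longrightarrow> proper_on S F) \<and>
     (\<forall>F. L F \<subseteq> S) \<and>
     (\<forall>x\<in>S. x \<in> L (principal {x})) \<and>
     (\<forall>F G. proper_on S F \<and> proper_on S G \<and> G \<le> F \<longrightarrow> L F \<subseteq> L G))"

typedef 'a convergence = "{SL :: 'a set \<times> ('a filter \<Rightarrow> 'a set). is_convergence SL}"
  by (rule exI[of _ "({}, \<lambda>_. {})"]) (simp add: is_convergence_def)

definition carrier :: "'a convergence \<Rightarrow> 'a set" where
  "carrier X = fst (Rep_convergence X)"

definition clim :: "'a convergence \<Rightarrow> 'a filter \<Rightarrow> 'a set" where
  "clim X = snd (Rep_convergence X)"

definition mk_convergence :: "'a set \<Rightarrow> ('a filter \<Rightarrow> 'a set) \<Rightarrow> 'a convergence" where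
  "mk_convergence S L = Abs_convergence (S, \<lambda>F. {x \<in> S. proper_on S F \<and> x \<in> L F})"

lemma convergence_axioms:
  shows lim_proper: "x \<in> clim X F \<Longrightarrow> proper_on (carrier X) F"
    and lim_carrier: "x \<in> clim X F \<Longrightarrow> x \<in> carrier X"
    and lim_principal: "x \<in> carrier X \<Longrightarrow> x \<in> clim X (principal {x})"
    and lim_mono: "x \<in> clim X F \<Longrightarrow> G \<noteq> bot \<Longrightarrow> G \<le> F \<Longrightarrow> x \<in> clim X G"
proof -
  have *: "is_convergence (carrier X, clim X)"
    using Rep_convergence[of X] by (simp add: carrier_def clim_def)
  show 1: "x \<in> clim X F \<Longrightarrow> proper_on (carrier X) F"
    using * unfolding is_convergence_def by blast
  show "x \<in> clim X F \<Longrightarrow> x \<in> carrier X"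
    using * unfolding is_convergence_def by blast
  show "x \<in> carrier X \<Longrightarrow> x \<in> clim X (principal {x})"
    using * unfolding is_convergence_def by blast
  assume "x \<in> clim X F" "G \<noteq> bot" "G \<le> F"
  moreover from this 1 have "proper_on (carrier X) F" "proper_on (carrier X) G"
    by (auto simp: proper_on_def)
  ultimately show "x \<in> clim X G"
    using * unfolding is_convergence_def by blast
qed

lemma convergence_eqI:
  assumes "carrier X = carrier Y" "\<And>F. clim X F = clim Y F"
  shows "X = Y"
  using assms unfolding carrier_def clim_def
  by (metis Rep_convergence_inject ext prod.collapse)

lemma mk_convergence:
  assumes "\<And>x. x \<in> S \<Longrightarrow> x \<in> L (principal {x})"
    and "\<And>F G. proper_on S F \<Longrightarrow> proper_on S G \<Longrightarrow> G \<le> F \<Longrightarrow> L F \<inter> S \<subseteq> L G"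
  shows carrier_mk_convergence: "carrier (mk_convergence S L) = S"
    and lim_mk_convergence: "clim (mk_convergence S L) F = {x \<in> S. proper_on S F \<and> x \<in> L F}"
proof -
  have "is_convergence (S, \<lambda>F. {x \<in> S. proper_on S F \<and> x \<in> L F})"
    using assms(1) assms(2) unfolding is_convergence_def
    by (auto simp: proper_on_def principal_eq_bot_iff)
  then have "Rep_convergence (mk_convergence S L) = (S, \<lambda>F. {x \<in> S. proper_on S F \<and> x \<in> L F})"
    by (simp add: mk_convergence_def Abs_convergence_inverse)
  then show "carrier (mk_convergence S L) = S"
    and "clim (mk_convergence S L) F = {x \<in> S. proper_on S F \<and> x \<in> L F}"
    by (simp_all add: carrier_def clim_def)
qed

lemma proper_on_filtermap:
  assumes "proper_on S F" "f \<in> S \<rightarrow> R"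
  shows "proper_on R (filtermap f F)"
proof -
  have "eventually (\<lambda>x. f x \<in> R) F"
    using assms by (auto simp: proper_on_def le_principal elim: eventually_mono)
  then show ?thesis
    using assms by (simp add: proper_on_def le_principal eventually_filtermap filtermap_bot_iff)
qed

definition finer :: "'a convergence \<Rightarrow> 'a convergence \<Rightarrow> bool" where
  "finer X Y \<longleftrightarrow> carrier X = carrier Y \<and> (\<forall>F. clim X F \<subseteq> clim Y F)"

lemma finer_antisym: "finer X Y \<Longrightarrow> finer Y X \<Longrightarrow> X = Y"
  by (intro convergence_eqI) (auto simp: finer_def)

text \<open>
  The supremum of a family of convergences; it is only used for nonempty families of convergences
  with the same underlying set.
\<close>

definition conv_Sup :: "'a convergence set \<Rightarrow> 'a convergence" where
  "conv_Sup \<X> = mk_convergence (\<Inter>X\<in>\<X>. carrier X) (\<lambda>F. \<Inter>X\<in>\<X>. clim X F)"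

lemma carrier_conv_Sup: "carrier (conv_Sup \<X>) = (\<Inter>X\<in>\<X>. carrier X)"
  and lim_conv_Sup:
    "clim (conv_Sup \<X>) F = {x \<in> (\<Inter>X\<in>\<X>. carrier X).
       proper_on (\<Inter>X\<in>\<X>. carrier X) F \<and> (\<forall>X\<in>\<X>. x \<in> clim X F)}"
proof -
  have *: "\<And>x. x \<in> (\<Inter>X\<in>\<X>. carrier X) \<Longrightarrow> x \<in> (\<Inter>X\<in>\<X>. clim X (principal {x}))"
    by (simp add: lim_principal)
  have **: "(\<Inter>X\<in>\<X>. clim X F) \<inter> (\<Inter>X\<in>\<X>. carrier X) \<subseteq> (\<Inter>X\<in>\<X>. clim X G)"
    if "proper_on (\<Inter>X\<in>\<X>. carrier X) G" "G \<le> F" for F G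
  proof
    fix x assume "x \<in> (\<Inter>X\<in>\<X>. clim X F) \<inter> (\<Inter>X\<in>\<X>. carrier X)"
    then have "x \<in> clim X G" if "X \<in> \<X>" for X
      using that lim_mono[of x X F G] \<open>proper_on _ G\<close> \<open>G \<le> F\<close> by (simp add: proper_on_def)
    then show "x \<in> (\<Inter>X\<in>\<X>. clim X G)"
      by simp
  qed
  note mk = mk_convergence[of "\<Inter>X\<in>\<X>. carrier X" "\<lambda>F. \<Inter>X\<in>\<X>. clim X F", OF * **]
  show "carrier (conv_Sup \<X>) = (\<Inter>X\<in>\<X>. carrier X)"
    unfolding conv_Sup_def by (rule mk(1))
  show "clim (conv_Sup \<X>) F = {x \<in> (\<Inter>X\<in>\<X>. carrier X).
       proper_on (\<Inter>X\<in>\<X>. carrier X) F \<and> (\<forall>X\<in>\<X>. x \<in> clim X F)}"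
    unfolding conv_Sup_def by (subst mk(2)) simp_all
qed

lemma lim_conv_Sup':
  assumes "\<X> \<noteq> {}" "\<And>X. X \<in> \<X> \<Longrightarrow> carrier X = S"
  shows "clim (conv_Sup \<X>) F = (\<Inter>X\<in>\<X>. clim X F)"
proof -
  obtain X where X: "X \<in> \<X>"
    using assms(1) by blast
  have S: "(\<Inter>X\<in>\<X>. carrier X) = S"
    using assms by simp
  have "x \<in> S \<and> proper_on S F" if "x \<in> clim X F" for x
    using that lim_proper[OF that] lim_carrier[OF that] assms(2)[OF X] by simp
  with X show ?thesis
    unfolding lim_conv_Sup S by blast
qed


section \<open>Topological convergences and open sets\<close>

definition conv_of_topology :: "'a topology \<Rightarrow> 'a convergence" where
  "conv_of_topology \<tau> = mk_convergence (topspace \<tau>) (\<lambda>F. {x. F \<le> nhdsin \<tau> x})"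

lemma carrier_conv_of_topology: "carrier (conv_of_topology \<tau>) = topspace \<tau>"
  and lim_conv_of_topology:
    "clim (conv_of_topology \<tau>) F =
       {x \<in> topspace \<tau>. proper_on (topspace \<tau>) F \<and> F \<le> nhdsin \<tau> x}"
proof -
  have *: "x \<in> {x'. principal {x} \<le> nhdsin \<tau> x'}" if "x \<in> topspace \<tau>" for x
    using that by (auto simp: le_filter_def eventually_nhdsin eventually_principal)
  show "carrier (conv_of_topology \<tau>) = topspace \<tau>"
    unfolding conv_of_topology_def by (rule carrier_mk_convergence) (use * in auto)
  show "clim (conv_of_topology \<tau>) F =
       {x \<in> topspace \<tau>. proper_on (topspace \<tau>) F \<and> F \<le> nhdsin \<tau> x}"
    unfolding conv_of_topology_def by (subst lim_mk_convergence) (use * in auto)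
qed

definition topological :: "'a convergence \<Rightarrow> bool" where
  "topological X \<longleftrightarrow> (\<exists>\<tau>. X = conv_of_topology \<tau>)"

definition conv_open :: "'a convergence \<Rightarrow> 'a set \<Rightarrow> bool" where
  "conv_open X U \<longleftrightarrow>
     U \<subseteq> carrier X \<and> (\<forall>F. clim X F \<inter> U \<noteq> {} \<longrightarrow> eventually (\<lambda>x. x \<in> U) F)"

definition open_topology :: "'a convergence \<Rightarrow> 'a topology" where
  "open_topology X = topology (conv_open X)"

lemma istopology_conv_open: "istopology (conv_open X)"
  unfolding istopology_def
proof (intro conjI allI impI)
  fix U V assume UV: "conv_open X U" "conv_open X V"
  have "eventually (\<lambda>x. x \<in> U \<inter> V) F" if "clim X F \<inter> (U \<inter> V) \<noteq> {}" for F
  proof -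
    from that have "clim X F \<inter> U \<noteq> {}" "clim X F \<inter> V \<noteq> {}"
      by auto
    with UV have "eventually (\<lambda>x. x \<in> U) F" "eventually (\<lambda>x. x \<in> V) F"
      by (simp_all add: conv_open_def)
    then show ?thesis
      by (simp add: eventually_conj)
  qed
  then show "conv_open X (U \<inter> V)"
    using UV by (auto simp: conv_open_def)
next
  fix \<U> assume \<U>: "\<forall>U\<in>\<U>. conv_open X U"
  show "conv_open X (\<Union>\<U>)"
    unfolding conv_open_def
  proof (intro conjI allI impI)
    show "\<Union>\<U> \<subseteq> carrier X"
      using \<U> by (auto simp: conv_open_def)
    fix F assume "clim X F \<inter> \<Union>\<U> \<noteq> {}"
    then obtain U where U: "U \<in> \<U>" "clim X F \<inter> U \<noteq> {}"
      by blast
    then have "eventually (\<lambda>x. x \<in> U) F"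
      using \<U> by (simp add: conv_open_def)
    then show "eventually (\<lambda>x. x \<in> \<Union>\<U>) F"
      by (rule eventually_mono) (use U in blast)
  qed
qed

lemma openin_open_topology: "openin (open_topology X) U \<longleftrightarrow> conv_open X U"
  by (simp add: open_topology_def istopology_conv_open)

lemma topspace_open_topology: "topspace (open_topology X) = carrier X"
proof -
  have "conv_open X (carrier X)"
    using lim_proper[of _ X] by (auto simp: conv_open_def proper_on_def le_principal)
  moreover have "U \<subseteq> carrier X" if "conv_open X U" for U
    using that by (simp add: conv_open_def)
  ultimately show ?thesis
    unfolding topspace_def openin_open_topology by blast
qed

definition T :: "'a convergence \<Rightarrow> 'a convergence" where
  "T X = conv_of_topology (open_topology X)"

lemma open_topology_conv_of_topology: "open_topology (conv_of_topology \<tau>) = \<tau>"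
proof -
  have "conv_open (conv_of_topology \<tau>) U \<longleftrightarrow> openin \<tau> U" for U
  proof
    assume U: "conv_open (conv_of_topology \<tau>) U"
    show "openin \<tau> U"
    proof (subst openin_subopen, intro ballI)
      fix x assume x: "x \<in> U"
      then have xt: "x \<in> topspace \<tau>"
        using U by (auto simp: conv_open_def carrier_conv_of_topology)
      have "nhdsin \<tau> x \<noteq> bot"
        using xt by (auto simp: trivial_limit_def eventually_nhdsin)
      moreover have "nhdsin \<tau> x \<le> principal (topspace \<tau>)"
        using xt by (auto simp: le_principal eventually_nhdsin)
      ultimately have "x \<in> clim (conv_of_topology \<tau>) (nhdsin \<tau> x)"
        using xt by (simp add: lim_conv_of_topology proper_on_def)
      then have "eventually (\<lambda>y. y \<in> U) (nhdsin \<tau> x)"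
        using U x unfolding conv_open_def by blast
      then show "\<exists>V. openin \<tau> V \<and> x \<in> V \<and> V \<subseteq> U"
        using xt by (auto simp: eventually_nhdsin)
    qed
  next
    assume U: "openin \<tau> U"
    have "eventually (\<lambda>y. y \<in> U) F" if "x \<in> clim (conv_of_topology \<tau>) F" "x \<in> U" for x F
      using that U by (auto simp: lim_conv_of_topology le_filter_def eventually_nhdsin)
    then show "conv_open (conv_of_topology \<tau>) U"
      using U openin_subset by (fastforce simp: conv_open_def carrier_conv_of_topology)
  qed
  then show ?thesis
    by (simp add: topology_eq openin_open_topology)
qed

definition core_compact :: "'a topology \<Rightarrow> bool" where
  "core_compact \<tau> \<longleftrightarrow>
     (\<forall>y\<in>topspace \<tau>. \<forall>V. openin \<tau> V \<and> y \<in> V \<longrightarrow>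
        (\<exists>U. openin \<tau> U \<and> y \<in> U \<and>
           (\<forall>\<C>. (\<forall>C\<in>\<C>. openin \<tau> C) \<and> V \<subseteq> \<Union>\<C> \<longrightarrow>
              (\<exists>\<D>. \<D> \<subseteq> \<C> \<and> finite \<D> \<and> U \<subseteq> \<Union>\<D>))))"


section \<open>Continuous maps, initial convergences, continuous convergence\<close>

definition conv_continuous :: "'a convergence \<Rightarrow> 'b convergence \<Rightarrow> ('a \<Rightarrow> 'b) \<Rightarrow> bool" where
  "conv_continuous X Y f \<longleftrightarrow>
     f \<in> carrier X \<rightarrow> carrier Y \<and> (\<forall>F x. x \<in> clim X F \<longrightarrow> f x \<in> clim Y (filtermap f F))"

definition initial :: "'a set \<Rightarrow> ('a \<Rightarrow> 'b) \<Rightarrow> 'b convergence \<Rightarrow> 'a convergence" where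
  "initial S f Y = (THE X. carrier X = S \<and> conv_continuous X Y f \<and>
     (\<forall>Z. carrier Z = S \<and> conv_continuous Z Y f \<longrightarrow> finer Z X))"

lemma initial_eq:
  assumes "f \<in> S \<rightarrow> carrier Y"
  shows carrier_initial: "carrier (initial S f Y) = S"
    and lim_initial: "clim (initial S f Y) F = {x \<in> S. proper_on S F \<and> f x \<in> clim Y (filtermap f F)}"
proof -
  define I where "I = mk_convergence S (\<lambda>F. {x. f x \<in> clim Y (filtermap f F)})"
  have *: "x \<in> {x'. f x' \<in> clim Y (filtermap f (principal {x}))}" if "x \<in> S" for x
    using assms that lim_principal[of "f x" Y] by (auto simp: filtermap_principal)
  have **: "{x. f x \<in> clim Y (filtermap f F)} \<inter> S \<subseteq> {x. f x \<in> clim Y (filtermap f G)}"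
    if "proper_on S F" "proper_on S G" "G \<le> F" for F G
  proof clarify
    fix x assume "f x \<in> clim Y (filtermap f F)"
    then show "f x \<in> clim Y (filtermap f G)"
      by (rule lim_mono) (use that in \<open>simp_all add: proper_on_def filtermap_bot_iff filtermap_mono\<close>)
  qed
  have cI: "carrier I = S"
    unfolding I_def by (rule carrier_mk_convergence[OF * **])
  have lI: "clim I F = {x \<in> S. proper_on S F \<and> f x \<in> clim Y (filtermap f F)}" for F
    unfolding I_def by (subst lim_mk_convergence[OF * **]) auto
  have "initial S f Y = I"
    unfolding initial_def
  proof (rule the_equality)
    show I: "carrier I = S \<and> conv_continuous I Y f \<and>
        (\<forall>Z. carrier Z = S \<and> conv_continuous Z Y f \<longrightarrow> finer Z I)"
    proof (intro conjI allI impI)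
      show "conv_continuous I Y f"
        using assms by (simp add: conv_continuous_def cI lI)
      fix Z assume Z: "carrier Z = S \<and> conv_continuous Z Y f"
      have "x \<in> clim I F" if "x \<in> clim Z F" for x F
        using Z that lim_proper[OF that] lim_carrier[OF that]
        by (simp add: lI conv_continuous_def)
      with Z show "finer Z I"
        by (auto simp: finer_def cI)
    qed (rule cI)
    fix X assume "carrier X = S \<and> conv_continuous X Y f \<and>
        (\<forall>Z. carrier Z = S \<and> conv_continuous Z Y f \<longrightarrow> finer Z X)"
    with I show "X = I"
      by (blast intro: finer_antisym)
  qed
  then show "carrier (initial S f Y) = S"
    and "clim (initial S f Y) F = {x \<in> S. proper_on S F \<and> f x \<in> clim Y (filtermap f F)}"
    by (simp_all add: cI lI)
qed

text \<open>Continuous maps are made extensional, so that they correspond to maps on the carrier.\<close>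

definition cmaps :: "'a convergence \<Rightarrow> 'b convergence \<Rightarrow> ('a \<Rightarrow> 'b) set" where
  "cmaps X Y = {f \<in> carrier X \<rightarrow>\<^sub>E carrier Y. conv_continuous X Y f}"

definition cont_conv :: "'a convergence \<Rightarrow> 'b convergence \<Rightarrow> ('a \<Rightarrow> 'b) convergence" where
  "cont_conv X Y = mk_convergence (cmaps X Y)
     (\<lambda>F. {f. \<forall>x\<in>carrier X. \<forall>G. x \<in> clim X G \<longrightarrow>
                f x \<in> clim Y (filtermap (\<lambda>(x, g). g x) (G \<times>\<^sub>F F))})"

lemma carrier_cont_conv: "carrier (cont_conv X Y) = cmaps X Y"
  and lim_cont_conv:
    "clim (cont_conv X Y) F = {f \<in> cmaps X Y. proper_on (cmaps X Y) F \<and>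
       (\<forall>x\<in>carrier X. \<forall>G. x \<in> clim X G \<longrightarrow>
          f x \<in> clim Y (filtermap (\<lambda>(x, g). g x) (G \<times>\<^sub>F F)))}"
proof -
  let ?L = "\<lambda>F. {f. \<forall>x\<in>carrier X. \<forall>G. x \<in> clim X G \<longrightarrow>
                f x \<in> clim Y (filtermap (\<lambda>(x, g). g x) (G \<times>\<^sub>F F))}"
  have *: "f \<in> ?L (principal {f})" if "f \<in> cmaps X Y" for f
  proof -
    have "filtermap (\<lambda>(x, g). g x) (G \<times>\<^sub>F principal {f}) = filtermap f G" for G
    proof (rule filter_eqI)
      fix P
      show "eventually P (filtermap (\<lambda>(x, g). g x) (G \<times>\<^sub>F principal {f})) =
          eventually P (filtermap f G)"
      proof
        assume "eventually P (filtermap (\<lambda>(x, g). g x) (G \<times>\<^sub>F principal {f}))"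
        then obtain Q R where "eventually Q G" "R f" "\<And>x g. Q x \<Longrightarrow> R g \<Longrightarrow> P (g x)"
          by (auto simp: eventually_filtermap eventually_prod_filter eventually_principal)
        then show "eventually P (filtermap f G)"
          by (auto simp: eventually_filtermap intro: eventually_mono[of Q G])
      next
        assume "eventually P (filtermap f G)"
        then show "eventually P (filtermap (\<lambda>(x, g). g x) (G \<times>\<^sub>F principal {f}))"
          unfolding eventually_filtermap eventually_prod_filter eventually_principal
          by (intro exI[of _ "\<lambda>x. P (f x)"] exI[of _ "\<lambda>g. g = f"]) simp
      qed
    qed
    with that show ?thesis
      by (auto simp: cmaps_def conv_continuous_def)
  qed
  have **: "?L F \<inter> cmaps X Y \<subseteq> ?L G"
    if "proper_on (cmaps X Y) F" "proper_on (cmaps X Y) G" "G \<le> F" for F G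
  proof clarify
    fix f x H
    assume f: "\<forall>x\<in>carrier X. \<forall>H. x \<in> clim X H \<longrightarrow> f x \<in> clim Y (filtermap (\<lambda>(x, g). g x) (H \<times>\<^sub>F F))"
      and x: "x \<in> carrier X" "x \<in> clim X H"
    have "H \<noteq> bot"
      using lim_proper[OF x(2)] by (simp add: proper_on_def)
    then have "filtermap (\<lambda>(x, g). g x) (H \<times>\<^sub>F G) \<noteq> bot"
      using that(2) by (simp add: filtermap_bot_iff prod_filter_eq_bot proper_on_def)
    moreover have "filtermap (\<lambda>(x, g). g x) (H \<times>\<^sub>F G) \<le> filtermap (\<lambda>(x, g). g x) (H \<times>\<^sub>F F)"
      using that(3) by (intro filtermap_mono prod_filter_mono) auto
    moreover have "f x \<in> clim Y (filtermap (\<lambda>(x, g). g x) (H \<times>\<^sub>F F))"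
      using f x by simp
    ultimately show "f x \<in> clim Y (filtermap (\<lambda>(x, g). g x) (H \<times>\<^sub>F G))"
      by (simp add: lim_mono)
  qed
  show "carrier (cont_conv X Y) = cmaps X Y"
    unfolding cont_conv_def by (rule carrier_mk_convergence[OF * **])
  show "clim (cont_conv X Y) F = {f \<in> cmaps X Y. proper_on (cmaps X Y) F \<and>
       (\<forall>x\<in>carrier X. \<forall>G. x \<in> clim X G \<longrightarrow>
          f x \<in> clim Y (filtermap (\<lambda>(x, g). g x) (G \<times>\<^sub>F F)))}"
    unfolding cont_conv_def by (subst lim_mk_convergence[OF * **]) auto
qed


section \<open>Epitopologies\<close>

text \<open>The points 0 and 1 are \<^term>\<open>False\<close> and \<^term>\<open>True\<close>.\<close>

definition sierpinski_topology :: "bool topology" where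
  "sierpinski_topology = topology (\<lambda>U. U \<in> {{}, {True}, UNIV})"

lemma openin_sierpinski_topology:
  "openin sierpinski_topology U \<longleftrightarrow> U \<in> {{}, {True}, UNIV}"
proof -
  have "istopology (\<lambda>U :: bool set. U \<in> {{}, {True}, UNIV})"
    unfolding istopology_def
  proof (intro conjI allI impI)
    fix \<U> :: "bool set set" assume \<U>: "\<forall>U\<in>\<U>. U \<in> {{}, {True}, UNIV}"
    then have "\<U> \<subseteq> {{}, {True}, UNIV}"
      by blast
    then have "\<U> \<in> Pow {{}, {True}, UNIV}"
      by blast
    then show "\<Union>\<U> \<in> {{}, {True}, UNIV}"
      unfolding Pow_insert Pow_empty by auto
  qed auto
  then show ?thesis
    by (simp add: sierpinski_topology_def)
qed

definition sierpinski :: "bool convergence" where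
  "sierpinski = conv_of_topology sierpinski_topology"

definition eval_map :: "'a convergence \<Rightarrow> 'a \<Rightarrow> ('a \<Rightarrow> bool) \<Rightarrow> bool" where
  "eval_map X x = (\<lambda>f\<in>cmaps X sierpinski. f x)"

definition epitopological :: "'a convergence \<Rightarrow> bool" where
  "epitopological X \<longleftrightarrow>
     X = initial (carrier X) (eval_map X) (cont_conv (cont_conv X sierpinski) sierpinski)"

definition EpiT :: "'a convergence \<Rightarrow> 'a convergence" where
  "EpiT X = initial (carrier X) (eval_map X) (cont_conv (T (cont_conv X sierpinski)) sierpinski)"

text \<open>
  Transfinite iteration of \<^const>\<open>EpiT\<close> along a well-order \<open>r\<close>. The elements of \<open>r\<close> stand for the
  ordinals \<open>\<ge> 1\<close>; in particular the least element stands for 1.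
\<close>

definition EpiT_iter :: "'o rel \<Rightarrow> 'o \<Rightarrow> 'a convergence \<Rightarrow> 'a convergence" where
  "EpiT_iter r \<alpha> X = wfrec (r - Id) (\<lambda>E \<alpha>.
     if underS r \<alpha> = {} then EpiT X else EpiT (conv_Sup (E ` underS r \<alpha>))) \<alpha>"

lemma EpiT_iter_unfold:
  assumes "Well_order r"
  shows "EpiT_iter r \<alpha> X =
    (if underS r \<alpha> = {} then EpiT X else EpiT (conv_Sup ((\<lambda>\<beta>. EpiT_iter r \<beta> X) ` underS r \<alpha>)))"
proof -
  have "wf (r - Id)"
    using assms by (simp add: well_order_on_def)
  moreover have "\<beta> \<in> underS r \<alpha> \<Longrightarrow> (\<beta>, \<alpha>) \<in> r - Id" for \<beta>
    by (simp add: underS_def)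
  ultimately show ?thesis
    unfolding EpiT_iter_def
    by (subst wfrec) (auto simp: cut_apply intro!: arg_cong[where f = "\<lambda>A. EpiT (conv_Sup A)"] image_cong)
qed

text \<open>
  A well-order without a last element, whose cardinality exceeds the number of convergences
  on \<^typ>\<open>'a\<close>. The iterates of an epitopological space become finer and finer, so they are
  stationary within an order of this length.
\<close>

definition ordinals :: "(nat + 'a convergence) set rel" where
  "ordinals = card_of UNIV"

lemma Well_order_ordinals: "Well_order ordinals"
  and Field_ordinals: "Field ordinals = UNIV"
  unfolding ordinals_def by (rule card_of_Well_order, rule Field_card_of)

definition d_T :: "'a convergence \<Rightarrow> 'a convergence" where
  "d_T X = (THE D. \<exists>\<alpha> :: (nat + 'a convergence) set.
     D = EpiT_iter ordinals \<alpha> X \<and> D = EpiT_iter ordinals (wo_rel.suc ordinals {\<alpha>}) X)"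

end

theory Submission
  imports Defs
begin

text \<open>
  Write \<open>[X, $]\<close> for the continuous dual of \<open>X\<close>, that is, the open subsets of \<open>X\<close> with continuous
  convergence.

  Suppose that \<open>T [X, $]\<close> is core compact. The continuous dual of a core compact topological space
  is again topological (\<open>topological_dual\<close>), so \<open>[T [X, $], $]\<close> is topological, and so is
  \<open>EpiT X\<close>, whose convergence is initial with respect to a map into that dual. Because \<open>X\<close> is
  epitopological, \<open>EpiT X\<close> is finer than \<open>X\<close>, and every iterate of \<open>EpiT\<close>, in particular
  \<open>d_T X\<close>, is finer than \<open>EpiT X\<close>. Together with the hypothesis on \<open>d_T X\<close> this closes a circle, in
  which \<open>\<ge>\<close> means finer: \<open>EpiT X \<ge> X \<ge> T (d_T X) \<ge> T (EpiT X) = EpiT X\<close>. So \<open>X = EpiT X\<close> is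
  topological. Convergence of neighbourhood filters in \<open>EpiT X\<close> says the following: if \<open>y\<close> belongs to
  the open set \<open>V\<close>, then there are a set \<open>\<O>\<close>, open in \<open>[X, $]\<close> and containing \<open>V\<close>, and a
  neighbourhood \<open>U\<close> of \<open>y\<close> contained in all members of \<open>\<O>\<close>. Open sets of \<open>[X, $]\<close> are compact
  families (\<open>conv_open_dual_compact\<close>): if some open sets cover \<open>V\<close>, then a finite union of them
  belongs to \<open>\<O>\<close> and therefore covers \<open>U\<close>. So \<open>X\<close> is core compact (\<open>core_compact_fixed_point\<close>).

  Conversely, if \<open>X\<close> is a core compact topological space, every open \<open>\<O>\<close> in \<open>[X, $]\<close> that contains
  \<open>V\<close> also contains some open \<open>W\<close> way below \<open>V\<close>. The family of all open sets that \<open>W\<close> is way below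
  is an open neighbourhood of \<open>V\<close>, and all its members contain \<open>W\<close>; since open families are closed
  under supersets, a single member of an open cover of \<open>\<O>\<close>, one to which \<open>W\<close> belongs,
  covers this neighbourhood (\<open>core_compact_dual\<close>).

  That \<open>d_T X\<close> is an iterate of \<open>EpiT\<close> at all (\<open>d_T_iterate\<close>) rests on the monotonicity of \<open>EpiT\<close>:
  the iterates increase, so that two equal consecutive ones stop the sequence, and
  strictly increasing iterates would inject a power set into the set that it is the power set of.
\<close>

section \<open>Continuous maps into the Sierpinski space\<close>

lemma lim_sierpinski: "b \<in> clim sierpinski F \<longleftrightarrow> F \<noteq> bot \<and> (b \<longrightarrow> eventually (\<lambda>c. c) F)"
proof -
  have top: "topspace sierpinski_topology = UNIV"
    unfolding topspace_def openin_sierpinski_topology by auto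
  have "F \<le> nhdsin sierpinski_topology b \<longleftrightarrow> (b \<longrightarrow> eventually (\<lambda>c. c) F)"
  proof
    assume le: "F \<le> nhdsin sierpinski_topology b"
    show "b \<longrightarrow> eventually (\<lambda>c. c) F"
    proof
      assume b
      then have "eventually (\<lambda>c. c) (nhdsin sierpinski_topology b)"
        unfolding eventually_nhdsin openin_sierpinski_topology
        by (intro disjI2 exI[of _ "{True}"]) auto
      with le show "eventually (\<lambda>c. c) F"
        by (rule filter_leD)
    qed
  next
    assume F: "b \<longrightarrow> eventually (\<lambda>c. c) F"
    have "eventually P F" if P: "eventually P (nhdsin sierpinski_topology b)" for P
    proof -
      obtain S where S: "openin sierpinski_topology S" "b \<in> S" "\<forall>x\<in>S. P x"
        using P by (auto simp: eventually_nhdsin top)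
      then consider "S = {True}" | "S = UNIV"
        by (auto simp: openin_sierpinski_topology)
      then show ?thesis
      proof cases
        case 1
        then show ?thesis
          using S F by (auto elim: eventually_mono)
      next
        case 2
        then show ?thesis
          using S by (auto intro!: always_eventually)
      qed
    qed
    then show "F \<le> nhdsin sierpinski_topology b"
      by (simp add: le_filter_def)
  qed
  then show ?thesis
    by (simp add: sierpinski_def lim_conv_of_topology top proper_on_def)
qed

lemma carrier_sierpinski: "carrier sierpinski = UNIV"
  unfolding sierpinski_def carrier_conv_of_topology topspace_def openin_sierpinski_topology
  by auto

lemma cmaps_sierpinski_iff:
  "f \<in> cmaps X sierpinski \<longleftrightarrow>
     f \<in> extensional (carrier X) \<and> conv_open X {x \<in> carrier X. f x}"
proof -
  have "conv_continuous X sierpinski f \<longleftrightarrow> conv_open X {x \<in> carrier X. f x}"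
  proof
    assume f: "conv_continuous X sierpinski f"
    have "eventually (\<lambda>y. y \<in> carrier X \<and> f y) F" if "x \<in> clim X F" "f x" for x F
    proof -
      have "f x \<in> clim sierpinski (filtermap f F)"
        using f that(1) unfolding conv_continuous_def by blast
      then have "eventually f F"
        using that by (simp add: lim_sierpinski eventually_filtermap)
      moreover have "eventually (\<lambda>y. y \<in> carrier X) F"
        using lim_proper[OF that(1)] by (simp add: proper_on_def le_principal)
      ultimately show ?thesis
        by (simp add: eventually_conj)
    qed
    then show "conv_open X {x \<in> carrier X. f x}"
      by (auto simp: conv_open_def)
  next
    assume f: "conv_open X {x \<in> carrier X. f x}"
    have "f x \<in> clim sierpinski (filtermap f F)" if x: "x \<in> clim X F" for x F
    proof -
      have "F \<noteq> bot"
        using lim_proper[OF x] by (simp add: proper_on_def)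
      moreover have "eventually f F" if "f x"
      proof -
        have "clim X F \<inter> {x \<in> carrier X. f x} \<noteq> {}"
          using x that lim_carrier[OF x] by blast
        then have "eventually (\<lambda>y. y \<in> {x \<in> carrier X. f x}) F"
          using f by (simp add: conv_open_def)
        then show ?thesis
          by (rule eventually_mono) simp
      qed
      ultimately show ?thesis
        by (simp add: lim_sierpinski filtermap_bot_iff eventually_filtermap)
    qed
    then show "conv_continuous X sierpinski f"
      by (simp add: conv_continuous_def carrier_sierpinski)
  qed
  then show ?thesis
    by (auto simp: cmaps_def carrier_sierpinski PiE_def)
qed

definition char_map :: "'a convergence \<Rightarrow> 'a set \<Rightarrow> 'a \<Rightarrow> bool" where
  "char_map X U = (\<lambda>x\<in>carrier X. x \<in> U)"

lemma char_map_in_cmaps: "conv_open X U \<Longrightarrow> char_map X U \<in> cmaps X sierpinski"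
proof -
  assume U: "conv_open X U"
  then have "{x \<in> carrier X. char_map X U x} = U"
    by (auto simp: char_map_def conv_open_def)
  with U show ?thesis
    by (simp add: cmaps_sierpinski_iff) (simp add: char_map_def)
qed

lemma conv_open_carrier: "conv_open X (carrier X)"
  using openin_topspace[of "open_topology X"]
  by (simp add: openin_open_topology topspace_open_topology)

text \<open>
  The cases \<open>f x = False\<close> impose no condition, since every proper filter converges to \<^term>\<open>False\<close>
  in the Sierpinski space; for \<open>f x = True\<close>, some member of \<open>G\<close> lies in all open sets of some
  member of \<open>F\<close>.
\<close>

lemma lim_dual:
  "f \<in> clim (cont_conv X sierpinski) F \<longleftrightarrow>
     f \<in> cmaps X sierpinski \<and> proper_on (cmaps X sierpinski) F \<and>
     (\<forall>x\<in>carrier X. f x \<longrightarrow> (\<forall>G. x \<in> clim X G \<longrightarrow>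
        (\<exists>P Q. eventually P G \<and> eventually Q F \<and> (\<forall>y g. P y \<longrightarrow> Q g \<longrightarrow> g y))))"
proof -
  have "f x \<in> clim sierpinski (filtermap (\<lambda>(x, g). g x) (G \<times>\<^sub>F F)) \<longleftrightarrow>
      (f x \<longrightarrow> (\<exists>P Q. eventually P G \<and> eventually Q F \<and> (\<forall>y g. P y \<longrightarrow> Q g \<longrightarrow> g y)))"
    if "x \<in> clim X G" "proper_on (cmaps X sierpinski) F" for x G
  proof -
    have "G \<times>\<^sub>F F \<noteq> bot"
      using that lim_proper[OF that(1)] by (simp add: proper_on_def prod_filter_eq_bot)
    then show ?thesis
      by (simp add: lim_sierpinski filtermap_bot_iff eventually_filtermap eventually_prod_filter)
  qed
  then show ?thesis
    unfolding lim_cont_conv by blast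
qed

lemma lim_nhdsin:
  assumes "z \<in> topspace \<tau>"
  shows "z \<in> clim (conv_of_topology \<tau>) (nhdsin \<tau> z)"
proof -
  have "nhdsin \<tau> z \<noteq> bot"
    using assms by (auto simp: trivial_limit_def eventually_nhdsin)
  moreover have "nhdsin \<tau> z \<le> principal (topspace \<tau>)"
    using assms by (auto simp: le_principal eventually_nhdsin)
  ultimately show ?thesis
    using assms by (simp add: lim_conv_of_topology proper_on_def)
qed

text \<open>
  Over a topological space it suffices to test with the neighbourhood filters, the coarsest
  convergent ones.
\<close>

lemma lim_dual_of_topology:
  fixes \<tau> :: "'a topology"
  defines "Z \<equiv> conv_of_topology \<tau>"
  shows "f \<in> clim (cont_conv Z sierpinski) F \<longleftrightarrow>
     f \<in> cmaps Z sierpinski \<and> proper_on (cmaps Z sierpinski) F \<and>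
     (\<forall>z\<in>topspace \<tau>. f z \<longrightarrow>
        (\<exists>N. openin \<tau> N \<and> z \<in> N \<and> eventually (\<lambda>g. \<forall>y\<in>N. g y) F))"
proof -
  have "(\<forall>G. z \<in> clim Z G \<longrightarrow>
        (\<exists>P Q. eventually P G \<and> eventually Q F \<and> (\<forall>y g. P y \<longrightarrow> Q g \<longrightarrow> g y))) \<longleftrightarrow>
      (\<exists>N. openin \<tau> N \<and> z \<in> N \<and> eventually (\<lambda>g. \<forall>y\<in>N. g y) F)"
    if z: "z \<in> topspace \<tau>" for z
  proof
    have lim: "z \<in> clim Z (nhdsin \<tau> z)"
      unfolding Z_def by (rule lim_nhdsin[OF z])
    assume "\<forall>G. z \<in> clim Z G \<longrightarrow>
        (\<exists>P Q. eventually P G \<and> eventually Q F \<and> (\<forall>y g. P y \<longrightarrow> Q g \<longrightarrow> g y))"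
    with lim obtain P Q where P: "eventually P (nhdsin \<tau> z)" and Q: "eventually Q F"
      and PQ: "\<And>y g. P y \<Longrightarrow> Q g \<Longrightarrow> g y"
      by blast
    from P z obtain N where "openin \<tau> N" "z \<in> N" "\<forall>y\<in>N. P y"
      by (auto simp: eventually_nhdsin)
    with Q PQ show "\<exists>N. openin \<tau> N \<and> z \<in> N \<and> eventually (\<lambda>g. \<forall>y\<in>N. g y) F"
      by (intro exI[of _ N]) (auto elim!: eventually_mono)
  next
    assume "\<exists>N. openin \<tau> N \<and> z \<in> N \<and> eventually (\<lambda>g. \<forall>y\<in>N. g y) F"
    then obtain N where N: "openin \<tau> N" "z \<in> N" "eventually (\<lambda>g. \<forall>y\<in>N. g y) F"
      by blast
    have "eventually (\<lambda>y. y \<in> N) (nhdsin \<tau> z)"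
      using N by (auto simp: eventually_nhdsin)
    then have "eventually (\<lambda>y. y \<in> N) G" if "z \<in> clim Z G" for G
      using that by (auto simp: Z_def lim_conv_of_topology intro: filter_leD)
    with N(3) show "\<forall>G. z \<in> clim Z G \<longrightarrow>
        (\<exists>P Q. eventually P G \<and> eventually Q F \<and> (\<forall>y g. P y \<longrightarrow> Q g \<longrightarrow> g y))"
      by blast
  qed
  then show ?thesis
    unfolding lim_dual by (simp add: Z_def carrier_conv_of_topology)
qed

text \<open>
  If \<open>f \<le> g\<close>, then the principal filter of \<open>g\<close> converges to \<open>f\<close> in the dual.
\<close>

lemma conv_open_dual_upward:
  assumes "conv_open (cont_conv Z sierpinski) \<O>" "f \<in> \<O>" "g \<in> cmaps Z sierpinski"
    and le: "\<And>z. z \<in> carrier Z \<Longrightarrow> f z \<Longrightarrow> g z"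
  shows "g \<in> \<O>"
proof -
  have f: "f \<in> cmaps Z sierpinski"
    using assms(1,2) by (auto simp: conv_open_def carrier_cont_conv)
  have "\<exists>P Q. eventually P G \<and> eventually Q (principal {g}) \<and> (\<forall>y h. P y \<longrightarrow> Q h \<longrightarrow> h y)"
    if z: "f z" "z \<in> clim Z G" for z G
  proof (intro exI conjI)
    have "clim Z G \<inter> {z \<in> carrier Z. f z} \<noteq> {}"
      using z lim_carrier[OF z(2)] by blast
    then have "eventually (\<lambda>y. y \<in> {z \<in> carrier Z. f z}) G"
      using f by (simp add: cmaps_sierpinski_iff conv_open_def)
    then show "eventually (\<lambda>y. g y) G"
      by (rule eventually_mono) (use le in auto)
    show "eventually (\<lambda>h. h = g) (principal {g})"
      by (simp add: eventually_principal)
  qed auto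
  then have "f \<in> clim (cont_conv Z sierpinski) (principal {g})"
    using f assms(3) by (auto simp: lim_dual proper_on_def principal_eq_bot_iff)
  then have "clim (cont_conv Z sierpinski) (principal {g}) \<inter> \<O> \<noteq> {}"
    using assms(2) by blast
  then have "eventually (\<lambda>h. h \<in> \<O>) (principal {g})"
    using assms(1) by (simp add: conv_open_def)
  then show ?thesis
    by (simp add: eventually_principal)
qed

text \<open>
  Open families in the dual are compact. The sets of all maps that are true on a given finite
  union of the cover \<open>\<W>\<close> generate a filter; it converges to \<open>f\<close> because every point where \<open>f\<close> is
  true lies in a single open member of \<open>\<W>\<close>. So one of the generating sets lies in \<open>\<O>\<close>.
\<close>

lemma conv_open_dual_compact:
  assumes \<O>: "conv_open (cont_conv Z sierpinski) \<O>" "f \<in> \<O>"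
    and \<W>: "\<And>W. W \<in> \<W> \<Longrightarrow> conv_open Z W" "{z \<in> carrier Z. f z} \<subseteq> \<Union>\<W>"
  obtains \<D> where "finite \<D>" "\<D> \<subseteq> \<W>"
    "\<And>g. g \<in> cmaps Z sierpinski \<Longrightarrow> (\<And>z. z \<in> \<Union>\<D> \<Longrightarrow> g z) \<Longrightarrow> g \<in> \<O>"
proof -
  define above where "above \<D> = {g \<in> cmaps Z sierpinski. \<forall>z\<in>\<Union>\<D>. g z}" for \<D>
  define F where "F = (INF \<D>\<in>{\<D>. finite \<D> \<and> \<D> \<subseteq> \<W>}. principal (above \<D>))"
  have ev: "eventually P F \<longleftrightarrow> (\<exists>\<D>\<in>{\<D>. finite \<D> \<and> \<D> \<subseteq> \<W>}. \<forall>g\<in>above \<D>. P g)" for P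
    unfolding F_def
  proof (subst eventually_INF_base)
    fix \<D> \<E> assume "\<D> \<in> {\<D>. finite \<D> \<and> \<D> \<subseteq> \<W>}" "\<E> \<in> {\<D>. finite \<D> \<and> \<D> \<subseteq> \<W>}"
    then show "\<exists>\<C>\<in>{\<D>. finite \<D> \<and> \<D> \<subseteq> \<W>}.
        principal (above \<C>) \<le> inf (principal (above \<D>)) (principal (above \<E>))"
      by (intro bexI[of _ "\<D> \<union> \<E>"]) (auto simp: above_def)
  qed (auto simp: eventually_principal)
  \<comment> \<open>The filter is proper, as the greatest element of the dual lies in all generating sets.\<close>
  have "char_map Z (carrier Z) \<in> above \<D>" if "\<D> \<subseteq> \<W>" for \<D>
    using char_map_in_cmaps[OF conv_open_carrier, of Z] that \<W>(1)
    by (auto simp: above_def char_map_def conv_open_def)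
  then have "F \<noteq> bot"
    unfolding trivial_limit_def ev by blast
  moreover have "F \<le> principal (cmaps Z sierpinski)"
    unfolding le_principal ev by (intro bexI[of _ "{}"]) (auto simp: above_def)
  moreover have "\<exists>P Q. eventually P G \<and> eventually Q F \<and> (\<forall>y g. P y \<longrightarrow> Q g \<longrightarrow> g y)"
    if z: "z \<in> carrier Z" "f z" "z \<in> clim Z G" for z G
  proof -
    obtain W where W: "W \<in> \<W>" "z \<in> W"
      using \<W>(2) z by blast
    then have "clim Z G \<inter> W \<noteq> {}"
      using z by blast
    then have "eventually (\<lambda>y. y \<in> W) G"
      using \<W>(1)[OF W(1)] by (simp add: conv_open_def)
    moreover have "eventually (\<lambda>g. \<forall>y\<in>W. g y) F"
      unfolding ev by (intro bexI[of _ "{W}"]) (use W in \<open>auto simp: above_def\<close>)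
    ultimately show ?thesis
      by blast
  qed
  moreover have "f \<in> cmaps Z sierpinski"
    using \<O> by (auto simp: conv_open_def carrier_cont_conv)
  ultimately have "f \<in> clim (cont_conv Z sierpinski) F"
    by (simp add: lim_dual proper_on_def)
  then have "clim (cont_conv Z sierpinski) F \<inter> \<O> \<noteq> {}"
    using \<O>(2) by blast
  then have "eventually (\<lambda>g. g \<in> \<O>) F"
    using \<O>(1) by (simp add: conv_open_def)
  then obtain \<D> where "finite \<D>" "\<D> \<subseteq> \<W>" "\<forall>g\<in>above \<D>. g \<in> \<O>"
    unfolding ev by blast
  then show thesis
    by (intro that[of \<D>]) (auto simp: above_def)
qed

text \<open>
  Evaluation at \<open>x\<close> is continuous on the dual: test the convergence with the principal
  ultrafilter of \<open>x\<close>.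
\<close>

lemma conv_open_dual_point:
  assumes "x \<in> carrier X"
  shows "conv_open (cont_conv X sierpinski) {f \<in> cmaps X sierpinski. f x}"
proof -
  have "eventually (\<lambda>g. g \<in> cmaps X sierpinski \<and> g x) F"
    if f: "f \<in> clim (cont_conv X sierpinski) F" "f x" for f F
  proof -
    obtain P Q where "eventually P (principal {x})" "eventually Q F" "\<forall>y g. P y \<longrightarrow> Q g \<longrightarrow> g y"
      using f assms lim_principal[OF assms] unfolding lim_dual by blast
    then have "eventually (\<lambda>g. g x) F"
      by (auto simp: eventually_principal elim!: eventually_mono)
    moreover have "eventually (\<lambda>g. g \<in> cmaps X sierpinski) F"
      using lim_proper[OF f(1)] by (simp add: carrier_cont_conv proper_on_def le_principal)
    ultimately show ?thesis
      by (simp add: eventually_conj)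
  qed
  then show ?thesis
    by (auto simp: conv_open_def carrier_cont_conv)
qed


section \<open>The topology of open sets\<close>

lemma carrier_T: "carrier (T X) = carrier X"
  by (simp add: T_def carrier_conv_of_topology topspace_open_topology)

lemma conv_open_conv_of_topology: "conv_open (conv_of_topology \<tau>) U \<longleftrightarrow> openin \<tau> U"
  by (metis open_topology_conv_of_topology openin_open_topology)

lemma openin_true_set:
  "g \<in> cmaps (conv_of_topology \<tau>) sierpinski \<Longrightarrow> openin \<tau> {z \<in> topspace \<tau>. g z}"
  by (simp add: cmaps_sierpinski_iff carrier_conv_of_topology conv_open_conv_of_topology)

lemma conv_open_T: "conv_open (T X) U \<longleftrightarrow> conv_open X U"
  by (simp add: T_def conv_open_conv_of_topology openin_open_topology)

lemma lim_T:
  "x \<in> clim (T X) F \<longleftrightarrow> x \<in> carrier X \<and> proper_on (carrier X) F \<and>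
     (\<forall>U. conv_open X U \<and> x \<in> U \<longrightarrow> eventually (\<lambda>y. y \<in> U) F)"
proof -
  have "F \<le> nhdsin (open_topology X) x \<longleftrightarrow>
      (\<forall>U. conv_open X U \<and> x \<in> U \<longrightarrow> eventually (\<lambda>y. y \<in> U) F)" if "x \<in> carrier X"
    using that
    unfolding le_filter_def eventually_nhdsin topspace_open_topology openin_open_topology
    by (metis (mono_tags, lifting) eventually_mono)
  then show ?thesis
    by (auto simp: T_def lim_conv_of_topology topspace_open_topology)
qed

lemma finer_T: "finer X (T X)"
proof -
  have "x \<in> clim (T X) F" if "x \<in> clim X F" for x F
    using that lim_proper[OF that] lim_carrier[OF that] unfolding lim_T conv_open_def by blast
  then show ?thesis
    by (auto simp: finer_def carrier_T)
qed

lemma finer_refl: "finer X X"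
  by (simp add: finer_def)

lemma finer_trans: "finer X Y \<Longrightarrow> finer Y Z \<Longrightarrow> finer X Z"
  by (fastforce simp: finer_def)

lemma conv_open_finer: "finer X Y \<Longrightarrow> conv_open Y U \<Longrightarrow> conv_open X U"
  unfolding conv_open_def finer_def by blast

lemma T_mono: "finer X Y \<Longrightarrow> finer (T X) (T Y)"
  using conv_open_finer[of X Y] by (auto simp: finer_def carrier_T lim_T)

lemma T_topological: "topological X \<Longrightarrow> T X = X"
  by (auto simp: topological_def T_def open_topology_conv_of_topology)

text \<open>
  \<open>X\<close> is always finer than \<open>T X\<close>, and the assumption is the converse comparison.
\<close>

lemma topologicalI:
  assumes "\<And>x F. x \<in> carrier X \<Longrightarrow> proper_on (carrier X) F \<Longrightarrow>
    (\<And>U. conv_open X U \<Longrightarrow> x \<in> U \<Longrightarrow> eventually (\<lambda>y. y \<in> U) F) \<Longrightarrow> x \<in> clim X F"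
  shows "topological X"
proof -
  have "finer (T X) X"
    using assms by (auto simp: finer_def carrier_T lim_T)
  then have "X = T X"
    by (intro finer_antisym finer_T)
  then show ?thesis
    unfolding topological_def T_def by blast
qed

text \<open>
  Preimages of open sets are open, and a filter that contains those around \<open>x\<close> is mapped to a
  filter converging to \<open>f x\<close>.
\<close>

lemma topological_initial:
  assumes "topological Y" "f \<in> S \<rightarrow> carrier Y"
  shows "topological (initial S f Y)"
proof (rule topologicalI)
  fix x F
  assume x: "x \<in> carrier (initial S f Y)" and F: "proper_on (carrier (initial S f Y)) F"
    and nhd: "\<And>U. conv_open (initial S f Y) U \<Longrightarrow> x \<in> U \<Longrightarrow> eventually (\<lambda>y. y \<in> U) F"
  have xS: "x \<in> S" and FS: "proper_on S F"
    using x F assms(2) by (simp_all add: carrier_initial)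
  have "eventually (\<lambda>y. y \<in> V) (filtermap f F)" if V: "conv_open Y V" "f x \<in> V" for V
  proof -
    have "conv_open (initial S f Y) {z \<in> S. f z \<in> V}"
      unfolding conv_open_def
    proof (intro conjI allI impI)
      show "{z \<in> S. f z \<in> V} \<subseteq> carrier (initial S f Y)"
        using assms(2) by (auto simp: carrier_initial)
      fix G assume "clim (initial S f Y) G \<inter> {z \<in> S. f z \<in> V} \<noteq> {}"
      then have G: "proper_on S G" and "clim Y (filtermap f G) \<inter> V \<noteq> {}"
        using assms(2) by (auto simp: lim_initial)
      then have "eventually (\<lambda>v. v \<in> V) (filtermap f G)"
        using V(1) by (simp add: conv_open_def)
      then have "eventually (\<lambda>z. f z \<in> V) G"
        by (simp add: eventually_filtermap)
      moreover have "eventually (\<lambda>z. z \<in> S) G"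
        using G by (simp add: proper_on_def le_principal)
      ultimately show "eventually (\<lambda>z. z \<in> {z \<in> S. f z \<in> V}) G"
        by eventually_elim simp
    qed
    then have "eventually (\<lambda>z. z \<in> {z \<in> S. f z \<in> V}) F"
      by (rule nhd) (use xS V in simp)
    then show ?thesis
      unfolding eventually_filtermap by (rule eventually_mono) simp
  qed
  then have "f x \<in> clim (T Y) (filtermap f F)"
    using assms(2) xS proper_on_filtermap[OF FS assms(2)] by (auto simp: lim_T)
  then show "x \<in> clim (initial S f Y) F"
    using xS FS assms by (simp add: lim_initial T_topological)
qed


section \<open>The way-below relation of a core compact topology\<close>

definition way_below :: "'a topology \<Rightarrow> 'a set \<Rightarrow> 'a set \<Rightarrow> bool" where
  "way_below \<tau> U V \<longleftrightarrow>
     (\<forall>\<C>. (\<forall>C\<in>\<C>. openin \<tau> C) \<and> V \<subseteq> \<Union>\<C> \<longrightarrow> (\<exists>\<D>. \<D> \<subseteq> \<C> \<and> finite \<D> \<and> U \<subseteq> \<Union>\<D>))"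

lemma core_compact_iff_way_below:
  "core_compact \<tau> \<longleftrightarrow>
     (\<forall>V. openin \<tau> V \<longrightarrow> (\<forall>y\<in>V. \<exists>U. openin \<tau> U \<and> y \<in> U \<and> way_below \<tau> U V))"
  unfolding core_compact_def way_below_def[symmetric] using openin_subset[of \<tau>] by blast

lemma way_below_mono:
  assumes "way_below \<tau> U V" "U' \<subseteq> U" "V \<subseteq> V'"
  shows "way_below \<tau> U' V'"
  unfolding way_below_def
proof (intro allI impI)
  fix \<C> assume "(\<forall>C\<in>\<C>. openin \<tau> C) \<and> V' \<subseteq> \<Union>\<C>"
  then have "(\<forall>C\<in>\<C>. openin \<tau> C) \<and> V \<subseteq> \<Union>\<C>"
    using assms(3) by auto
  then obtain \<D> where "\<D> \<subseteq> \<C>" "finite \<D>" "U \<subseteq> \<Union>\<D>"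
    using assms(1) unfolding way_below_def by meson
  with assms(2) show "\<exists>\<D>. \<D> \<subseteq> \<C> \<and> finite \<D> \<and> U' \<subseteq> \<Union>\<D>"
    by (meson order_trans)
qed

lemma way_below_subset: "way_below \<tau> U V \<Longrightarrow> openin \<tau> V \<Longrightarrow> U \<subseteq> V"
  unfolding way_below_def by (drule spec[of _ "{V}"]) (auto dest: subset_singletonD)

lemma way_below_Union:
  assumes "finite \<D>" "\<And>U. U \<in> \<D> \<Longrightarrow> way_below \<tau> U V"
  shows "way_below \<tau> (\<Union>\<D>) V"
  unfolding way_below_def
proof (intro allI impI)
  fix \<C> assume "(\<forall>C\<in>\<C>. openin \<tau> C) \<and> V \<subseteq> \<Union>\<C>"
  then have "\<forall>U\<in>\<D>. \<exists>\<E>. \<E> \<subseteq> \<C> \<and> finite \<E> \<and> U \<subseteq> \<Union>\<E>"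
    using assms(2) unfolding way_below_def by blast
  then obtain \<E> where \<E>: "\<And>U. U \<in> \<D> \<Longrightarrow> \<E> U \<subseteq> \<C> \<and> finite (\<E> U) \<and> U \<subseteq> \<Union>(\<E> U)"
    by metis
  then show "\<exists>\<E>. \<E> \<subseteq> \<C> \<and> finite \<E> \<and> \<Union>\<D> \<subseteq> \<Union>\<E>"
  proof (intro exI conjI)
    show "\<Union>(\<E> ` \<D>) \<subseteq> \<C>" "finite (\<Union>(\<E> ` \<D>))"
      using \<E> assms(1) by auto
    show "\<Union>\<D> \<subseteq> \<Union>(\<Union>(\<E> ` \<D>))"
      using \<E> by (fastforce dest: subsetD)
  qed
qed

text \<open>
  By applying core compactness twice, \<open>V\<close> is covered by open sets \<open>A\<close> that admit an open \<open>B\<close>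
  between \<open>A\<close> and \<open>V\<close> in the way-below relation. Finitely many of these \<open>A\<close> cover \<open>U\<close>,
  and the union of their \<open>B\<close> interpolates.
\<close>

lemma way_below_interpolation:
  assumes \<tau>: "core_compact \<tau>" and V: "openin \<tau> V" and UV: "way_below \<tau> U V"
  obtains W where "openin \<tau> W" "way_below \<tau> U W" "way_below \<tau> W V"
proof -
  define \<C> where
    "\<C> = {A. openin \<tau> A \<and> (\<exists>B. openin \<tau> B \<and> way_below \<tau> A B \<and> way_below \<tau> B V)}"
  have "V \<subseteq> \<Union>\<C>"
  proof
    fix y assume "y \<in> V"
    then obtain B where B: "openin \<tau> B" "y \<in> B" "way_below \<tau> B V"
      using \<tau> V unfolding core_compact_iff_way_below by blast
    then obtain A where "openin \<tau> A" "y \<in> A" "way_below \<tau> A B"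
      using \<tau> unfolding core_compact_iff_way_below by blast
    with B show "y \<in> \<Union>\<C>"
      unfolding \<C>_def by blast
  qed
  moreover have "\<forall>C\<in>\<C>. openin \<tau> C"
    by (simp add: \<C>_def)
  ultimately obtain \<D> where \<D>: "\<D> \<subseteq> \<C>" "finite \<D>" "U \<subseteq> \<Union>\<D>"
    using UV unfolding way_below_def by meson
  have "\<forall>A\<in>\<D>. \<exists>B. openin \<tau> B \<and> way_below \<tau> A B \<and> way_below \<tau> B V"
    using \<D>(1) by (auto simp: \<C>_def)
  then obtain B where B: "\<And>A. A \<in> \<D> \<Longrightarrow> openin \<tau> (B A) \<and> way_below \<tau> A (B A) \<and> way_below \<tau> (B A) V"
    by metis
  show thesis
  proof
    show "openin \<tau> (\<Union>(B ` \<D>))"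
      using B by blast
    have "way_below \<tau> A (\<Union>(B ` \<D>))" if "A \<in> \<D>" for A
      by (rule way_below_mono[of _ A "B A"]) (use B that in auto)
    then have "way_below \<tau> (\<Union>\<D>) (\<Union>(B ` \<D>))"
      by (rule way_below_Union[OF \<D>(2)])
    then show "way_below \<tau> U (\<Union>(B ` \<D>))"
      by (rule way_below_mono[OF _ \<D>(3) order_refl])
    show "way_below \<tau> (\<Union>(B ` \<D>)) V"
      by (rule way_below_Union) (use B \<D>(2) in auto)
  qed
qed

text \<open>
  The main use of interpolation. Let \<open>F\<close> converge to \<open>f\<close>, and let \<open>W'\<close> lie between \<open>W\<close> and the true
  set of \<open>f\<close>. That set is covered by open sets on each of which the maps \<open>g\<close> are eventually true,
  so the maps are eventually true on all of \<open>W'\<close>, by finiteness of a subcover. Then \<open>W\<close>, being way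
  below \<open>W'\<close>, is way below the true set of \<open>g\<close>.
\<close>

lemma conv_open_dual_way_above:
  fixes \<tau> :: "'a topology"
  assumes \<tau>: "core_compact \<tau>"
  defines "Z \<equiv> conv_of_topology \<tau>"
  shows "conv_open (cont_conv Z sierpinski)
    {g \<in> cmaps Z sierpinski. way_below \<tau> W {z \<in> topspace \<tau>. g z}}"
proof -
  have "eventually (\<lambda>g. g \<in> cmaps Z sierpinski \<and> way_below \<tau> W {z \<in> topspace \<tau>. g z}) F"
    if f: "f \<in> clim (cont_conv Z sierpinski) F" and W: "way_below \<tau> W {z \<in> topspace \<tau>. f z}"
    for f F
  proof -
    have fF: "f \<in> cmaps Z sierpinski" "proper_on (cmaps Z sierpinski) F"
      using lim_carrier[OF f] lim_proper[OF f] by (simp_all add: carrier_cont_conv)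
    then have "openin \<tau> {z \<in> topspace \<tau>. f z}"
      unfolding Z_def by (intro openin_true_set)
    then obtain W' where W': "openin \<tau> W'" "way_below \<tau> W W'"
      and W'f: "way_below \<tau> W' {z \<in> topspace \<tau>. f z}"
      by (rule way_below_interpolation[OF \<tau> _ W])
    define \<C> where "\<C> = {N. openin \<tau> N \<and> eventually (\<lambda>g. \<forall>y\<in>N. g y) F}"
    have "{z \<in> topspace \<tau>. f z} \<subseteq> \<Union>\<C>"
      using f unfolding Z_def lim_dual_of_topology \<C>_def by blast
    moreover have "\<forall>C\<in>\<C>. openin \<tau> C"
      by (simp add: \<C>_def)
    ultimately obtain \<D> where \<D>: "\<D> \<subseteq> \<C>" "finite \<D>" "W' \<subseteq> \<Union>\<D>"
      using W'f unfolding way_below_def by meson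
    have "eventually (\<lambda>g. \<forall>N\<in>\<D>. \<forall>y\<in>N. g y) F"
      using \<D> by (intro eventually_ball_finite) (auto simp: \<C>_def)
    moreover have "eventually (\<lambda>g. g \<in> cmaps Z sierpinski) F"
      using fF by (simp add: proper_on_def le_principal)
    ultimately show ?thesis
    proof eventually_elim
      case (elim g)
      then have "W' \<subseteq> {z \<in> topspace \<tau>. g z}"
        using \<D>(3) openin_subset[OF W'(1)] by blast
      with W'(2) elim show ?case
        using way_below_mono[OF _ order_refl] by blast
    qed
  qed
  then show ?thesis
    by (auto simp: conv_open_def carrier_cont_conv)
qed

text \<open>
  A filter that contains all the open families of \<open>conv_open_dual_way_above\<close> around \<open>f\<close> converges
  to \<open>f\<close>, since by core compactness any point of the true set of \<open>f\<close> has a neighbourhood \<open>N\<close> way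
  below that set, and a map is true on \<open>N\<close> if \<open>N\<close> is way below its true set.
\<close>

lemma topological_dual:
  assumes \<tau>: "core_compact \<tau>"
  shows "topological (cont_conv (conv_of_topology \<tau>) sierpinski)"
proof (rule topologicalI)
  let ?Z = "conv_of_topology \<tau>"
  fix f F
  assume f: "f \<in> carrier (cont_conv ?Z sierpinski)"
    and F: "proper_on (carrier (cont_conv ?Z sierpinski)) F"
    and nhd: "\<And>\<O>. conv_open (cont_conv ?Z sierpinski) \<O> \<Longrightarrow> f \<in> \<O> \<Longrightarrow> eventually (\<lambda>g. g \<in> \<O>) F"
  have "\<exists>N. openin \<tau> N \<and> z \<in> N \<and> eventually (\<lambda>g. \<forall>y\<in>N. g y) F"
    if z: "z \<in> topspace \<tau>" "f z" for z
  proof -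
    have "openin \<tau> {z \<in> topspace \<tau>. f z}"
      using f openin_true_set by (simp add: carrier_cont_conv)
    then obtain N where N: "openin \<tau> N" "z \<in> N" "way_below \<tau> N {z \<in> topspace \<tau>. f z}"
      using \<tau> z unfolding core_compact_iff_way_below by blast
    have "eventually (\<lambda>g. g \<in> {g \<in> cmaps ?Z sierpinski. way_below \<tau> N {z \<in> topspace \<tau>. g z}}) F"
      by (rule nhd[OF conv_open_dual_way_above[OF \<tau>]]) (use N f in \<open>simp add: carrier_cont_conv\<close>)
    then have "eventually (\<lambda>g. \<forall>y\<in>N. g y) F"
    proof (rule eventually_mono)
      fix g assume "g \<in> {g \<in> cmaps ?Z sierpinski. way_below \<tau> N {z \<in> topspace \<tau>. g z}}"
      then have "N \<subseteq> {z \<in> topspace \<tau>. g z}"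
        using openin_true_set way_below_subset by blast
      then show "\<forall>y\<in>N. g y"
        by blast
    qed
    with N show ?thesis
      by blast
  qed
  then show "f \<in> clim (cont_conv ?Z sierpinski) F"
    using f F unfolding lim_dual_of_topology carrier_cont_conv by blast
qed

text \<open>
  The open sets way below the true set of \<open>f\<close> cover it, so compactness of \<open>\<O>\<close> provides a finite
  union \<open>W\<close> of them in \<open>\<O>\<close>. The open family \<open>\<U>\<close> of the maps whose true set \<open>W\<close> is way below
  contains \<open>f\<close> and consists of maps that are true on \<open>W\<close>. Since open families are upward closed,
  \<open>\<U>\<close> is contained in any open family to which \<open>W\<close> belongs.
\<close>

lemma core_compact_dual:
  assumes \<tau>: "core_compact \<tau>"
  shows "core_compact (open_topology (cont_conv (conv_of_topology \<tau>) sierpinski))"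
  unfolding core_compact_iff_way_below openin_open_topology
proof (intro allI impI ballI)
  let ?Z = "conv_of_topology \<tau>"
  fix \<O> f assume \<O>: "conv_open (cont_conv ?Z sierpinski) \<O>" and f: "f \<in> \<O>"
  have f_cmaps: "f \<in> cmaps ?Z sierpinski"
    using \<O> f by (auto simp: conv_open_def carrier_cont_conv)
  define \<W> where "\<W> = {W. openin \<tau> W \<and> way_below \<tau> W {z \<in> topspace \<tau>. f z}}"
  have "{z \<in> carrier ?Z. f z} \<subseteq> \<Union>\<W>"
    using \<tau> openin_true_set[OF f_cmaps] unfolding core_compact_iff_way_below \<W>_def
    by (auto simp: carrier_conv_of_topology)
  then obtain \<D> where \<D>: "finite \<D>" "\<D> \<subseteq> \<W>"
    and \<D>\<O>: "\<And>g. g \<in> cmaps ?Z sierpinski \<Longrightarrow> (\<And>z. z \<in> \<Union>\<D> \<Longrightarrow> g z) \<Longrightarrow> g \<in> \<O>"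
    using conv_open_dual_compact[OF \<O> f, of \<W>]
    by (auto simp: \<W>_def conv_open_conv_of_topology)
  define W where "W = \<Union>\<D>"
  have W: "openin \<tau> W" "way_below \<tau> W {z \<in> topspace \<tau>. f z}"
    unfolding W_def using \<D> by (auto simp: \<W>_def intro: way_below_Union)
  have W_cmaps: "char_map ?Z W \<in> cmaps ?Z sierpinski"
    using W by (intro char_map_in_cmaps) (simp add: conv_open_conv_of_topology)
  have "char_map ?Z W \<in> \<O>"
  proof (rule \<D>\<O>[OF W_cmaps])
    show "char_map ?Z W z" if "z \<in> \<Union>\<D>" for z
      using that openin_subset[OF W(1)]
      by (auto simp: W_def char_map_def carrier_conv_of_topology)
  qed
  define \<U> where "\<U> = {g \<in> cmaps ?Z sierpinski. way_below \<tau> W {z \<in> topspace \<tau>. g z}}"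
  have "way_below (open_topology (cont_conv ?Z sierpinski)) \<U> \<O>"
    unfolding way_below_def openin_open_topology
  proof (intro allI impI)
    fix \<CC> assume \<CC>: "(\<forall>\<C>\<in>\<CC>. conv_open (cont_conv ?Z sierpinski) \<C>) \<and> \<O> \<subseteq> \<Union>\<CC>"
    then obtain \<C> where \<C>: "\<C> \<in> \<CC>" "char_map ?Z W \<in> \<C>"
      using \<open>char_map ?Z W \<in> \<O>\<close> by blast
    have "\<U> \<subseteq> \<C>"
    proof
      fix g assume g: "g \<in> \<U>"
      then have "W \<subseteq> {z \<in> topspace \<tau>. g z}"
        unfolding \<U>_def using openin_true_set way_below_subset by blast
      then show "g \<in> \<C>"
        using g \<CC> \<C> by (intro conv_open_dual_upward[of ?Z \<C> "char_map ?Z W" g])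
          (auto simp: \<U>_def char_map_def carrier_conv_of_topology)
    qed
    with \<C> show "\<exists>\<D>. \<D> \<subseteq> \<CC> \<and> finite \<D> \<and> \<U> \<subseteq> \<Union>\<D>"
      by (intro exI[of _ "{\<C>}"]) auto
  qed
  moreover have "conv_open (cont_conv ?Z sierpinski) \<U>"
    unfolding \<U>_def by (rule conv_open_dual_way_above[OF \<tau>])
  moreover have "f \<in> \<U>"
    using f_cmaps W by (simp add: \<U>_def)
  ultimately show "\<exists>\<U>. conv_open (cont_conv ?Z sierpinski) \<U> \<and> f \<in> \<U> \<and>
      way_below (open_topology (cont_conv ?Z sierpinski)) \<U> \<O>"
    by blast
qed


section \<open>The operator \<open>EpiT\<close>\<close>

lemma cmaps_antitone: "finer X X' \<Longrightarrow> cmaps X' Y \<subseteq> cmaps X Y"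
  unfolding cmaps_def conv_continuous_def finer_def by (auto dest!: subsetD)

text \<open>
  The contravariance of the continuous dual, for the identity from a finer space to a coarser one.
\<close>

lemma cont_conv_antitone:
  assumes "finer X X'" "f \<in> clim (cont_conv X' Y) F"
  shows "f \<in> clim (cont_conv X Y) F"
proof -
  have sub: "cmaps X' Y \<subseteq> cmaps X Y"
    by (rule cmaps_antitone[OF assms(1)])
  then have "proper_on (cmaps X Y) F" if "proper_on (cmaps X' Y) F"
    using that order_trans[of F "principal (cmaps X' Y)"] by (simp add: proper_on_def)
  with sub assms show ?thesis
    unfolding lim_cont_conv finer_def by (simp add: subset_iff)
qed

lemma eval_map_in_bidual: "eval_map X \<in> carrier X \<rightarrow> cmaps (cont_conv X sierpinski) sierpinski"
proof
  fix x assume x: "x \<in> carrier X"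
  have "{f \<in> cmaps X sierpinski. eval_map X x f} = {f \<in> cmaps X sierpinski. f x}"
    by (auto simp: eval_map_def)
  then show "eval_map X x \<in> cmaps (cont_conv X sierpinski) sierpinski"
    using conv_open_dual_point[OF x]
    by (simp add: cmaps_sierpinski_iff[of _ "cont_conv X sierpinski"] carrier_cont_conv)
       (simp add: eval_map_def)
qed

lemma cmaps_T_sierpinski: "cmaps (T X) sierpinski = cmaps X sierpinski"
  by (auto simp: cmaps_sierpinski_iff carrier_T conv_open_T)

lemma eval_map_in_T_bidual:
  "eval_map X \<in> carrier X \<rightarrow> carrier (cont_conv (T (cont_conv X sierpinski)) sierpinski)"
  using eval_map_in_bidual by (simp add: carrier_cont_conv cmaps_T_sierpinski)

lemma carrier_EpiT: "carrier (EpiT X) = carrier X"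
  unfolding EpiT_def by (rule carrier_initial[OF eval_map_in_T_bidual])

text \<open>
  The definition of \<^const>\<open>EpiT\<close> unwound by means of \<open>lim_dual_of_topology\<close> for the space
  \<open>T [X, $]\<close>.
\<close>

lemma lim_EpiT:
  "x \<in> clim (EpiT X) F \<longleftrightarrow> x \<in> carrier X \<and> proper_on (carrier X) F \<and>
     (\<forall>f\<in>cmaps X sierpinski. f x \<longrightarrow>
        (\<exists>\<O>. conv_open (cont_conv X sierpinski) \<O> \<and> f \<in> \<O> \<and> eventually (\<lambda>y. \<forall>g\<in>\<O>. g y) F))"
proof -
  let ?D = "cont_conv X sierpinski"
  have ev: "eventually (\<lambda>y. \<forall>g\<in>\<O>. eval_map X y g) F \<longleftrightarrow> eventually (\<lambda>y. \<forall>g\<in>\<O>. g y) F"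
    if "conv_open ?D \<O>" for \<O>
  proof -
    have "\<O> \<subseteq> cmaps X sierpinski"
      using that by (simp add: conv_open_def carrier_cont_conv)
    then show ?thesis
      by (intro arg_cong[of _ _ "\<lambda>P. eventually P F"] ext ball_cong) (auto simp: eval_map_def)
  qed
  have "x \<in> clim (EpiT X) F \<longleftrightarrow> x \<in> carrier X \<and> proper_on (carrier X) F \<and>
      eval_map X x \<in> clim (cont_conv (T ?D) sierpinski) (filtermap (eval_map X) F)"
    unfolding EpiT_def by (simp add: lim_initial[OF eval_map_in_T_bidual])
  also have "\<dots> \<longleftrightarrow> x \<in> carrier X \<and> proper_on (carrier X) F \<and>
     (\<forall>f\<in>cmaps X sierpinski. eval_map X x f \<longrightarrow>
        (\<exists>\<O>. conv_open ?D \<O> \<and> f \<in> \<O> \<and> eventually (\<lambda>y. \<forall>g\<in>\<O>. eval_map X y g) F))"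
    using eval_map_in_bidual[of X] proper_on_filtermap[OF _ eval_map_in_bidual, of X F]
    unfolding T_def lim_dual_of_topology unfolding T_def[symmetric]
    by (auto simp: cmaps_T_sierpinski topspace_open_topology carrier_cont_conv
        openin_open_topology eventually_filtermap)
  also have "\<dots> \<longleftrightarrow> x \<in> carrier X \<and> proper_on (carrier X) F \<and>
     (\<forall>f\<in>cmaps X sierpinski. f x \<longrightarrow>
        (\<exists>\<O>. conv_open ?D \<O> \<and> f \<in> \<O> \<and> eventually (\<lambda>y. \<forall>g\<in>\<O>. g y) F))"
    using ev by (auto simp: eval_map_def cong: conj_cong)
  finally show ?thesis .
qed

text \<open>
  A coarser space has fewer open sets, and its dual converges more finely on them; so the trace of
  an open family of the dual of \<open>X\<close> is an open family of the dual of \<open>X'\<close>, and the trace has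
  a larger intersection.
\<close>

lemma EpiT_mono:
  assumes "finer X X'"
  shows "finer (EpiT X) (EpiT X')"
proof -
  have car: "carrier X = carrier X'"
    using assms by (simp add: finer_def)
  have sub: "cmaps X' sierpinski \<subseteq> cmaps X sierpinski"
    by (rule cmaps_antitone[OF assms])
  have trace: "conv_open (cont_conv X' sierpinski) (\<O> \<inter> cmaps X' sierpinski)"
    if \<O>: "conv_open (cont_conv X sierpinski) \<O>" for \<O>
    unfolding conv_open_def
  proof (intro conjI allI impI)
    show "\<O> \<inter> cmaps X' sierpinski \<subseteq> carrier (cont_conv X' sierpinski)"
      by (simp add: carrier_cont_conv)
    fix F assume "clim (cont_conv X' sierpinski) F \<inter> (\<O> \<inter> cmaps X' sierpinski) \<noteq> {}"
    then obtain f where f: "f \<in> clim (cont_conv X' sierpinski) F" "f \<in> \<O>"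
      by blast
    then have "clim (cont_conv X sierpinski) F \<inter> \<O> \<noteq> {}"
      using cont_conv_antitone[OF assms] by blast
    then have "eventually (\<lambda>g. g \<in> \<O>) F"
      using \<O> by (simp add: conv_open_def)
    moreover have "eventually (\<lambda>g. g \<in> cmaps X' sierpinski) F"
      using lim_proper[OF f(1)] by (simp add: carrier_cont_conv proper_on_def le_principal)
    ultimately show "eventually (\<lambda>g. g \<in> \<O> \<inter> cmaps X' sierpinski) F"
      by eventually_elim simp
  qed
  have "x \<in> clim (EpiT X') F" if x: "x \<in> clim (EpiT X) F" for x F
  proof -
    have "\<exists>\<O>. conv_open (cont_conv X' sierpinski) \<O> \<and> f \<in> \<O> \<and> eventually (\<lambda>y. \<forall>g\<in>\<O>. g y) F"
      if f: "f \<in> cmaps X' sierpinski" "f x" for f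
    proof -
      obtain \<O> where \<O>: "conv_open (cont_conv X sierpinski) \<O>" "f \<in> \<O>"
        "eventually (\<lambda>y. \<forall>g\<in>\<O>. g y) F"
        using x f sub unfolding lim_EpiT by blast
      have "eventually (\<lambda>y. \<forall>g\<in>\<O> \<inter> cmaps X' sierpinski. g y) F"
        using \<O>(3) by (rule eventually_mono) blast
      with trace[OF \<O>(1)] \<O>(2) f(1) show ?thesis
        by blast
    qed
    with x car show ?thesis
      by (simp add: lim_EpiT)
  qed
  then show ?thesis
    using car by (auto simp: finer_def carrier_EpiT)
qed

text \<open>
  Passing from \<open>[X, $]\<close> to the coarser \<open>T [X, $]\<close> makes the bidual finer, and the bidual formed
  with \<open>[X, $]\<close> itself induces the convergence of the epitopological space \<open>X\<close>.
\<close>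

lemma finer_EpiT:
  assumes "epitopological X"
  shows "finer (EpiT X) X"
proof -
  let ?B = "cont_conv (cont_conv X sierpinski) sierpinski"
  have ev: "eval_map X \<in> carrier X \<rightarrow> carrier ?B"
    using eval_map_in_bidual by (simp add: carrier_cont_conv)
  have "x \<in> clim X F" if x: "x \<in> clim (EpiT X) F" for x F
  proof -
    have "eval_map X x \<in> clim ?B (filtermap (eval_map X) F)" "x \<in> carrier X" "proper_on (carrier X) F"
      using x cont_conv_antitone[OF finer_T]
      unfolding EpiT_def lim_initial[OF eval_map_in_T_bidual] by blast+
    then have "x \<in> clim (initial (carrier X) (eval_map X) ?B) F"
      by (simp add: lim_initial[OF ev])
    then show ?thesis
      using assms by (simp add: epitopological_def)
  qed
  then show ?thesis
    by (auto simp: finer_def carrier_EpiT)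
qed

lemma topological_EpiT:
  assumes "core_compact (open_topology (cont_conv X sierpinski))"
  shows "topological (EpiT X)"
  unfolding EpiT_def
  by (intro topological_initial eval_map_in_T_bidual) (simp add: T_def topological_dual assms)

text \<open>
  For \<open>y\<close> in an open set \<open>V\<close>, the neighbourhood filter of \<open>y\<close> converges in \<open>EpiT X\<close>, which yields an
  open family \<open>\<O>\<close> around \<open>V\<close> all of whose members contain one neighbourhood \<open>U\<close> of \<open>y\<close>. Compactness
  of \<open>\<O>\<close> makes \<open>U\<close> way below \<open>V\<close>.
\<close>

lemma core_compact_fixed_point:
  assumes "topological X" "EpiT X = X"
  shows "core_compact (open_topology X)"
proof -
  obtain \<tau> where X: "X = conv_of_topology \<tau>"
    using assms(1) by (auto simp: topological_def)
  have "\<exists>U. openin \<tau> U \<and> y \<in> U \<and> way_below \<tau> U V" if V: "openin \<tau> V" "y \<in> V" for V y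
  proof -
    have y: "y \<in> topspace \<tau>"
      using V openin_subset by blast
    have "y \<in> clim (EpiT X) (nhdsin \<tau> y)"
      using lim_nhdsin[OF y] assms(2) by (simp add: X)
    moreover have "char_map X V \<in> cmaps X sierpinski" "char_map X V y"
      using V y char_map_in_cmaps[of X V]
      by (simp_all add: X conv_open_conv_of_topology char_map_def carrier_conv_of_topology)
    ultimately obtain \<O> where \<O>: "conv_open (cont_conv X sierpinski) \<O>" "char_map X V \<in> \<O>"
      "eventually (\<lambda>y. \<forall>g\<in>\<O>. g y) (nhdsin \<tau> y)"
      unfolding lim_EpiT by blast
    then obtain U where U: "openin \<tau> U" "y \<in> U" "\<And>z g. z \<in> U \<Longrightarrow> g \<in> \<O> \<Longrightarrow> g z"
      using y by (auto simp: eventually_nhdsin)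
    have "way_below \<tau> U V"
      unfolding way_below_def
    proof (intro allI impI)
      fix \<C> assume \<C>: "(\<forall>C\<in>\<C>. openin \<tau> C) \<and> V \<subseteq> \<Union>\<C>"
      then have "{z \<in> carrier X. char_map X V z} \<subseteq> \<Union>\<C>"
        by (auto simp: char_map_def)
      then obtain \<D> where \<D>: "finite \<D>" "\<D> \<subseteq> \<C>"
        and \<D>\<O>: "\<And>g. g \<in> cmaps X sierpinski \<Longrightarrow> (\<And>z. z \<in> \<Union>\<D> \<Longrightarrow> g z) \<Longrightarrow> g \<in> \<O>"
        using conv_open_dual_compact[OF \<O>(1,2), of \<C>] \<C>
        by (auto simp: X conv_open_conv_of_topology)
      have D: "openin \<tau> (\<Union>\<D>)"
        using \<D> \<C> by blast
      have "char_map X (\<Union>\<D>) \<in> \<O>"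
      proof (rule \<D>\<O>)
        show "char_map X (\<Union>\<D>) \<in> cmaps X sierpinski"
          using D by (intro char_map_in_cmaps) (simp add: X conv_open_conv_of_topology)
        show "char_map X (\<Union>\<D>) z" if "z \<in> \<Union>\<D>" for z
          using that openin_subset[OF D] by (auto simp: char_map_def X carrier_conv_of_topology)
      qed
      then have "U \<subseteq> \<Union>\<D>"
        using U(3)[of _ "char_map X (\<Union>\<D>)"] openin_subset[OF U(1)]
        by (auto simp: char_map_def X carrier_conv_of_topology)
      with \<D> show "\<exists>\<D>. \<D> \<subseteq> \<C> \<and> finite \<D> \<and> U \<subseteq> \<Union>\<D>"
        by blast
    qed
    with U show ?thesis
      by blast
  qed
  then show ?thesis
    by (simp add: X open_topology_conv_of_topology core_compact_iff_way_below)
qed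


section \<open>Transfinite iteration\<close>

lemma finer_conv_Sup_upper:
  assumes "Y \<in> \<X>" "\<And>Y. Y \<in> \<X> \<Longrightarrow> carrier Y = S"
  shows "finer (conv_Sup \<X>) Y"
proof -
  have "clim (conv_Sup \<X>) F = (\<Inter>X\<in>\<X>. clim X F)" for F
    by (rule lim_conv_Sup'[where S = S]) (use assms in auto)
  moreover have "carrier (conv_Sup \<X>) = S"
    using assms by (auto simp: carrier_conv_Sup)
  ultimately show ?thesis
    using assms by (auto simp: finer_def)
qed

lemma finer_conv_Sup_least:
  assumes "\<X> \<noteq> {}" "\<And>Y. Y \<in> \<X> \<Longrightarrow> finer Z Y"
  shows "finer Z (conv_Sup \<X>)"
proof -
  have car: "carrier Y = carrier Z" if "Y \<in> \<X>" for Y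
    using assms(2)[OF that] by (simp add: finer_def)
  have "clim (conv_Sup \<X>) F = (\<Inter>X\<in>\<X>. clim X F)" for F
    by (rule lim_conv_Sup'[where S = "carrier Z"]) (use assms car in auto)
  moreover have "carrier (conv_Sup \<X>) = carrier Z"
    using assms(1) car by (auto simp: carrier_conv_Sup)
  moreover have "clim Z F \<subseteq> clim Y F" if "Y \<in> \<X>" for Y F
    using assms(2)[OF that] by (simp add: finer_def)
  ultimately show ?thesis
    by (simp add: finer_def INF_greatest)
qed

text \<open>
  The space to which \<^const>\<open>EpiT\<close> is applied at stage \<open>\<alpha>\<close>. Taking \<open>X\<close> itself before the least stage
  lets one equation cover all stages.
\<close>

definition EpiT_prior :: "'o rel \<Rightarrow> 'o \<Rightarrow> 'a convergence \<Rightarrow> 'a convergence" where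
  "EpiT_prior r \<alpha> X =
     (if underS r \<alpha> = {} then X else conv_Sup ((\<lambda>\<beta>. EpiT_iter r \<beta> X) ` underS r \<alpha>))"

lemma EpiT_iter_prior: "Well_order r \<Longrightarrow> EpiT_iter r \<alpha> X = EpiT (EpiT_prior r \<alpha> X)"
  by (subst EpiT_iter_unfold) (simp_all add: EpiT_prior_def)

context
  fixes r :: "'o rel" and X :: "'a convergence"
  assumes r: "Well_order r" and infl: "finer (EpiT X) X"
begin

lemma finer_EpiT_iter_EpiT: "finer (EpiT_iter r \<alpha> X) (EpiT X)"
  and finer_EpiT_prior: "finer (EpiT_prior r \<alpha> X) X"
proof -
  have step: "finer (EpiT_prior r \<alpha> X) X"
    if IH: "\<And>\<beta>. \<beta> \<in> underS r \<alpha> \<Longrightarrow> finer (EpiT_iter r \<beta> X) (EpiT X)" for \<alpha>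
  proof (cases "underS r \<alpha> = {}")
    case True
    then show ?thesis
      by (simp add: EpiT_prior_def finer_refl)
  next
    case False
    then obtain \<beta> where \<beta>: "\<beta> \<in> underS r \<alpha>"
      by blast
    have "finer (conv_Sup ((\<lambda>\<beta>. EpiT_iter r \<beta> X) ` underS r \<alpha>)) (EpiT_iter r \<beta> X)"
      by (rule finer_conv_Sup_upper[where S = "carrier X"])
        (use \<beta> IH in \<open>auto simp: finer_def carrier_EpiT\<close>)
    then have "finer (EpiT_prior r \<alpha> X) (EpiT_iter r \<beta> X)"
      using False by (simp add: EpiT_prior_def)
    then show ?thesis
      using IH[OF \<beta>] infl finer_trans by blast
  qed
  show iter: "finer (EpiT_iter r \<alpha> X) (EpiT X)" for \<alpha>
  proof (induction \<alpha> rule: wo_rel.well_order_induct[of r])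
    case 1
    show ?case
      using r by (simp add: wo_rel_def)
  next
    case (2 \<alpha>)
    then have "finer (EpiT_prior r \<alpha> X) X"
      by (intro step) (auto simp: underS_def)
    then show ?case
      by (simp add: EpiT_iter_prior[OF r] EpiT_mono)
  qed
  show "finer (EpiT_prior r \<alpha> X) X"
    by (intro step iter)
qed

lemma carrier_EpiT_iter: "carrier (EpiT_iter r \<alpha> X) = carrier X"
  using finer_EpiT_iter_EpiT[of \<alpha>] by (simp add: finer_def carrier_EpiT)

lemma finer_EpiT_prior_iter:
  assumes "\<beta> \<in> underS r \<alpha>"
  shows "finer (EpiT_prior r \<alpha> X) (EpiT_iter r \<beta> X)"
  unfolding EpiT_prior_def using assms
  by (auto intro!: finer_conv_Sup_upper[where S = "carrier X"] simp: carrier_EpiT_iter)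

lemma underS_trans: "\<beta> \<in> underS r \<alpha> \<Longrightarrow> \<gamma> \<in> underS r \<beta> \<Longrightarrow> \<gamma> \<in> underS r \<alpha>"
  using r unfolding underS_def order_on_defs
  by (auto dest: transD antisymD)

text \<open>
  The suprema of the earlier stages increase, and \<^const>\<open>EpiT\<close> is monotone.
\<close>

lemma EpiT_iter_increasing:
  assumes "\<beta> \<in> underS r \<alpha>"
  shows "finer (EpiT_iter r \<alpha> X) (EpiT_iter r \<beta> X)"
proof -
  have "finer (EpiT_prior r \<alpha> X) (EpiT_prior r \<beta> X)"
  proof (cases "underS r \<beta> = {}")
    case True
    then show ?thesis
      using finer_EpiT_prior[of \<alpha>] by (simp add: EpiT_prior_def[of _ \<beta>])
  next
    case False
    then show ?thesis
      unfolding EpiT_prior_def[of _ \<beta>]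
      using finer_EpiT_prior_iter[of _ \<alpha>] underS_trans[OF assms]
      by (auto intro: finer_conv_Sup_least)
  qed
  then show ?thesis
    by (simp add: EpiT_iter_prior[OF r] EpiT_mono)
qed

text \<open>
  If stage \<open>\<alpha>\<close> and its successor \<open>\<alpha>'\<close> give the same space \<open>D\<close>, then \<open>EpiT D = D\<close>, because the
  supremum of the stages before \<open>\<alpha>'\<close> is the greatest of them, \<open>D\<close>. By induction, the supremum of
  the stages before any later \<open>\<gamma>\<close> is \<open>D\<close> as well.
\<close>

lemma EpiT_iter_stationary:
  assumes stat: "EpiT_iter r \<alpha> X = EpiT_iter r \<alpha>' X"
    and \<alpha>': "underS r \<alpha>' = insert \<alpha> (underS r \<alpha>)"
    and "\<alpha> \<in> underS r \<gamma>"
  shows "EpiT_iter r \<gamma> X = EpiT_iter r \<alpha> X"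
proof -
  define D where "D = EpiT_iter r \<alpha> X"
  have prior: "EpiT_prior r \<gamma> X = D"
    if \<gamma>: "\<alpha> \<in> underS r \<gamma>" and le: "\<And>\<beta>. \<beta> \<in> underS r \<gamma> \<Longrightarrow> finer D (EpiT_iter r \<beta> X)" for \<gamma>
  proof (rule finer_antisym)
    show "finer (EpiT_prior r \<gamma> X) D"
      unfolding D_def by (rule finer_EpiT_prior_iter[OF \<gamma>])
    show "finer D (EpiT_prior r \<gamma> X)"
      unfolding EpiT_prior_def using \<gamma> le by (auto intro: finer_conv_Sup_least)
  qed
  have below: "finer D (EpiT_iter r \<beta> X)" if "\<beta> = \<alpha> \<or> \<beta> \<in> underS r \<alpha>" for \<beta>
    using that EpiT_iter_increasing by (auto simp: D_def finer_refl)
  have "EpiT_prior r \<alpha>' X = D"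
    by (rule prior) (use \<alpha>' below in auto)
  then have fixed: "EpiT D = D"
    using stat by (simp add: D_def EpiT_iter_prior[OF r, of \<alpha>'])
  have "\<alpha> \<in> underS r \<gamma> \<longrightarrow> EpiT_iter r \<gamma> X = D"
  proof (induction \<gamma> rule: wo_rel.well_order_induct[of r])
    case 1
    show ?case
      using r by (simp add: wo_rel_def)
  next
    case (2 \<gamma>)
    show ?case
    proof
      assume \<gamma>: "\<alpha> \<in> underS r \<gamma>"
      have "finer D (EpiT_iter r \<beta> X)" if \<beta>: "\<beta> \<in> underS r \<gamma>" for \<beta>
      proof (cases "\<alpha> \<in> underS r \<beta>")
        case True
        then show ?thesis
          using 2 \<beta> by (auto simp: underS_def finer_refl)
      next
        case False
        have "\<alpha> \<in> Field r" "\<beta> \<in> Field r"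
          using \<gamma> \<beta> by (auto simp: underS_def Field_def)
        then have "\<beta> = \<alpha> \<or> \<beta> \<in> underS r \<alpha>"
          using False r by (auto simp: underS_def order_on_defs total_on_def)
        then show ?thesis
          by (rule below)
      qed
      then show "EpiT_iter r \<gamma> X = D"
        using prior[OF \<gamma>] fixed by (simp add: EpiT_iter_prior[OF r])
    qed
  qed
  with assms(3) show ?thesis
    by (simp add: D_def)
qed

end

text \<open>
  The successor exists since an infinite cardinal has no greatest element.
\<close>

lemma suc_ordinals:
  fixes \<alpha> :: "(nat + 'a convergence) set"
  defines "r \<equiv> ordinals :: (nat + 'a convergence) set rel"
  shows "underS r (wo_rel.suc r {\<alpha>}) = insert \<alpha> (underS r \<alpha>)"
proof -
  have wo: "wo_rel r"
    using Well_order_ordinals by (simp add: wo_rel_def r_def)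
  have "infinite (UNIV :: (nat + 'a convergence) set set)"
    by (simp add: Finite_Set.finite_set)
  moreover have "Card_order r"
    unfolding r_def ordinals_def by (rule card_of_Card_order)
  ultimately obtain \<beta> where \<beta>: "\<alpha> \<noteq> \<beta>" "(\<alpha>, \<beta>) \<in> r"
    using infinite_Card_order_limit[of r \<alpha>] by (auto simp: r_def Field_ordinals)
  have ne: "AboveS r {\<alpha>} \<noteq> {}"
    using \<beta> by (auto simp: AboveS_def r_def Field_ordinals)
  have F: "{\<alpha>} \<subseteq> Field r"
    by (simp add: r_def Field_ordinals)
  have gr: "wo_rel.suc r {\<alpha>} \<noteq> \<alpha>" "(\<alpha>, wo_rel.suc r {\<alpha>}) \<in> r"
    using wo_rel.suc_greater[OF wo F ne, of \<alpha>] by auto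
  have least: "(wo_rel.suc r {\<alpha>}, \<gamma>) \<in> r" if "\<gamma> \<noteq> \<alpha>" "(\<alpha>, \<gamma>) \<in> r" for \<gamma>
    using that by (intro wo_rel.suc_least_AboveS[OF wo]) (auto simp: AboveS_def r_def Field_ordinals)
  have lo: "Linear_order r"
    using Well_order_ordinals[where 'a = 'a] by (simp add: r_def well_order_on_def)
  show ?thesis
  proof (intro subset_antisym subsetI)
    fix \<gamma> assume \<gamma>: "\<gamma> \<in> underS r (wo_rel.suc r {\<alpha>})"
    then have "\<not> (\<gamma> \<noteq> \<alpha> \<and> (\<alpha>, \<gamma>) \<in> r)"
      using least lo by (auto simp: underS_def order_on_defs dest: antisymD)
    then show "\<gamma> \<in> insert \<alpha> (underS r \<alpha>)"
      using lo by (auto simp: underS_def order_on_defs total_on_def r_def Field_ordinals)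
  next
    fix \<gamma> assume \<gamma>: "\<gamma> \<in> insert \<alpha> (underS r \<alpha>)"
    then show "\<gamma> \<in> underS r (wo_rel.suc r {\<alpha>})"
      using gr lo by (auto simp: underS_def order_on_defs dest: transD antisymD)
  qed
qed

text \<open>
  If consecutive iterates always differed, then the increasing sequence of iterates would be
  injective, and would embed the power set of a sum type into that type, against Cantor's theorem.
  So a stationary stage exists, and by \<open>EpiT_iter_stationary\<close> any two stationary stages give the same
  space, which makes the definite description in \<^const>\<open>d_T\<close> well defined.
\<close>

lemma d_T_iterate:
  fixes X :: "'a convergence"
  assumes "finer (EpiT X) X"
  shows "\<exists>\<alpha> :: (nat + 'a convergence) set. d_T X = EpiT_iter ordinals \<alpha> X"
proof -
  let ?r = "ordinals :: (nat + 'a convergence) set rel"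
  define E where "E \<alpha> = EpiT_iter ?r \<alpha> X" for \<alpha>
  define s where "s \<alpha> = wo_rel.suc ?r {\<alpha>}" for \<alpha>
  have under_s: "underS ?r (s \<alpha>) = insert \<alpha> (underS ?r \<alpha>)" for \<alpha>
    unfolding s_def by (rule suc_ordinals)
  have inc: "finer (E \<beta>) (E \<alpha>)" if "\<alpha> \<in> underS ?r \<beta>" for \<alpha> \<beta>
    unfolding E_def by (rule EpiT_iter_increasing[OF Well_order_ordinals assms that])
  have stat: "E \<beta> = E \<alpha>" if "E \<alpha> = E (s \<alpha>)" "\<alpha> \<in> underS ?r \<beta>" for \<alpha> \<beta>
    using EpiT_iter_stationary[OF Well_order_ordinals assms _ under_s that(2)] that(1)
    by (simp add: E_def)
  have total: "\<alpha> = \<beta> \<or> \<alpha> \<in> underS ?r \<beta> \<or> \<beta> \<in> underS ?r \<alpha>" for \<alpha> \<beta>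
    using Well_order_ordinals[where 'a = 'a]
    by (auto simp: underS_def order_on_defs total_on_def Field_ordinals)
  have "\<exists>\<alpha>. E \<alpha> = E (s \<alpha>)"
  proof (rule ccontr)
    assume no: "\<nexists>\<alpha>. E \<alpha> = E (s \<alpha>)"
    have ne: "E \<alpha> \<noteq> E \<beta>" if \<alpha>\<beta>: "\<alpha> \<in> underS ?r \<beta>" for \<alpha> \<beta>
    proof
      assume eq: "E \<alpha> = E \<beta>"
      \<comment> \<open>Stage \<open>s \<alpha>\<close> comes no later than \<open>\<beta>\<close>, so its iterate is squeezed between two equal ones.\<close>
      have "s \<alpha> \<notin> insert \<alpha> (underS ?r \<alpha>)"
        using under_s by (metis underS_notIn)
      moreover have "\<beta> \<notin> insert \<alpha> (underS ?r \<alpha>)"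
        using \<alpha>\<beta> Well_order_ordinals[where 'a = 'a]
        by (auto simp: underS_def order_on_defs dest: antisymD)
      ultimately have "s \<alpha> = \<beta> \<or> s \<alpha> \<in> underS ?r \<beta>"
        using total[of "s \<alpha>" \<beta>] under_s by blast
      then have "finer (E \<beta>) (E (s \<alpha>))"
        using inc finer_refl by blast
      moreover have "finer (E (s \<alpha>)) (E \<alpha>)"
        by (rule inc) (simp add: under_s)
      ultimately have "E \<alpha> = E (s \<alpha>)"
        using eq finer_antisym by metis
      with no show False
        by blast
    qed
    then have "inj E"
      using total by (metis injI)
    then have "inj (\<lambda>\<alpha>. Inr (E \<alpha>) :: nat + 'a convergence)"
      by (simp add: inj_def)
    then show False
      using Cantors_theorem by (metis inj_imp_surj_inv surj_def Pow_UNIV image_iff UNIV_I subset_UNIV)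
  qed
  then obtain \<alpha> where \<alpha>: "E \<alpha> = E (s \<alpha>)"
    by blast
  have "d_T X = E \<alpha>"
    unfolding d_T_def E_def[symmetric] s_def[symmetric]
  proof (rule the_equality)
    show "\<exists>\<beta>. E \<alpha> = E \<beta> \<and> E \<alpha> = E (s \<beta>)"
      using \<alpha> by blast
    fix D assume "\<exists>\<beta>. D = E \<beta> \<and> D = E (s \<beta>)"
    then obtain \<beta> where "D = E \<beta>" "E \<beta> = E (s \<beta>)"
      by blast
    then show "D = E \<alpha>"
      using total[of \<alpha> \<beta>] stat[OF \<alpha>, of \<beta>] stat[of \<beta> \<alpha>] by auto
  qed
  then show ?thesis
    unfolding E_def by blast
qed

theorem theorem6:
  fixes X :: "'a convergence"
  assumes "epitopological X"
    and "finer X (T (d_T X))"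
  shows "core_compact (open_topology (cont_conv X sierpinski)) \<longleftrightarrow>
           topological X \<and> core_compact (open_topology X)"
proof
  assume "core_compact (open_topology (cont_conv X sierpinski))"
  then have top: "topological (EpiT X)"
    by (rule topological_EpiT)
  have infl: "finer (EpiT X) X"
    by (rule finer_EpiT[OF assms(1)])
  obtain \<alpha> :: "(nat + 'a convergence) set" where "d_T X = EpiT_iter ordinals \<alpha> X"
    using d_T_iterate[OF infl] by blast
  then have "finer (d_T X) (EpiT X)"
    using finer_EpiT_iter_EpiT[OF Well_order_ordinals infl] by simp
  then have "finer (T (d_T X)) (EpiT X)"
    using T_mono T_topological[OF top] by metis
  then have "EpiT X = X"
    using finer_trans[OF assms(2)] infl finer_antisym by blast
  with top show "topological X \<and> core_compact (open_topology X)"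
    using core_compact_fixed_point by simp
next
  assume "topological X \<and> core_compact (open_topology X)"
  then show "core_compact (open_topology (cont_conv X sierpinski))"
    using core_compact_dual by (auto simp: topological_def open_topology_conv_of_topology)
qed

end
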